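(* Let $\mathbf b=(b_1,b_2)\in\mathbb N^2$ with $\gcd(b_1,b_2)=1$, let $r\ge1$ be an integer and $\boldsymbol\alpha=(\alpha_1,\dots,\alpha_r)$ with $0<\alpha_j<1$. For $1\le j\le r$ let $(P^{(j)}_i)_{i\ge0}$ be an $\alpha_j$-random walk, the $r$ walks being mutually independent. Let $Y_i=1$ if all of $P^{(1)}_i,\dots,P^{(r)}_i$ are $\mathbf b$-visible from the origin and $Y_i=0$ otherwise, and let $\overline R(n)=\frac1n\sum_{i=1}^nY_i$. Then almost surely $$\lim_{n\to\infty}\overline R(n)=\prod_p\Big(1-\frac1{p^{b_\star}}+\frac1{p^{b_\star}}\Big(1-\frac1{p^{b^\star}}\Big)^r\Big),$$ where $b_\star=\min(b_1,b_2)$, $b^\star=\max(b_1,b_2)$ and $p$ runs over all primes.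
   Context: $\mathbf b$-visibility: given two distinct lattice points $P=(p_1,p_2)$, $Q=(q_1,q_2)\in\mathbb Z^2$, they determine a curve through both of the form $a_1(y-q_2)^{b_1}=a_2(x-q_1)^{b_2}$ for some $(a_1,a_2)\in\mathbb Q^2\setminus\{(0,0)\}$; $P$ is called $\mathbf b$-visible from $Q$ if no other lattice point lies on the segment of this curve between $P$ and $Q$. A point $P\ne(0,0)$ is $\mathbf b$-visible if it is $\mathbf b$-visible from the origin. An $\alpha$-random walk ($0<\alpha<1$) starting at the origin is defined by $P_0=(0,0)$ and $P_{i+1}=P_i+(1,0)$ with probability $\alpha$, $P_{i+1}=P_i+(0,1)$ with probability $1-\alpha$, the steps being independent. *)

theory Defs
  imports "HOL-Probability.Probability" "HOL-Computational_Algebra.Primes"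
begin

definition bcurve :: "nat \<Rightarrow> nat \<Rightarrow> rat \<Rightarrow> rat \<Rightarrow> int \<times> int \<Rightarrow> real \<times> real \<Rightarrow> bool" where
  "bcurve b1 b2 a1 a2 Q R \<longleftrightarrow>
     real_of_rat a1 * (snd R - real_of_int (snd Q)) ^ b1
       = real_of_rat a2 * (fst R - real_of_int (fst Q)) ^ b2"

text \<open>Lattice point R lies in the closed coordinate box spanned by P and Q
  (the segment of the curve between P and Q is the part of the curve in this box).\<close>
definition in_box :: "int \<times> int \<Rightarrow> int \<times> int \<Rightarrow> int \<times> int \<Rightarrow> bool" where
  "in_box P Q R \<longleftrightarrow>
     min (fst P) (fst Q) \<le> fst R \<and> fst R \<le> max (fst P) (fst Q) \<and>
     min (snd P) (snd Q) \<le> snd R \<and> snd R \<le> max (snd P) (snd Q)"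

definition b_visible_from :: "nat \<Rightarrow> nat \<Rightarrow> int \<times> int \<Rightarrow> int \<times> int \<Rightarrow> bool" where
  "b_visible_from b1 b2 Q P \<longleftrightarrow> P \<noteq> Q \<and>
     (\<exists>a1 a2 :: rat. (a1, a2) \<noteq> (0, 0) \<and>
        bcurve b1 b2 a1 a2 Q (real_of_int (fst P), real_of_int (snd P)) \<and>
        bcurve b1 b2 a1 a2 Q (real_of_int (fst Q), real_of_int (snd Q)) \<and>
        (\<forall>R :: int \<times> int. R \<noteq> P \<and> R \<noteq> Q \<and> in_box P Q R \<longrightarrow>
            \<not> bcurve b1 b2 a1 a2 Q (real_of_int (fst R), real_of_int (snd R))))"

definition b_visible :: "nat \<Rightarrow> nat \<Rightarrow> int \<times> int \<Rightarrow> bool" where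
  "b_visible b1 b2 P \<longleftrightarrow> P \<noteq> (0, 0) \<and> b_visible_from b1 b2 (0, 0) P"

text \<open>Position after i steps of the walk driven by step variables xi i
  (True = step (1,0), False = step (0,1)), starting at the origin.\<close>
definition walk :: "(nat \<Rightarrow> 'a \<Rightarrow> bool) \<Rightarrow> nat \<Rightarrow> 'a \<Rightarrow> int \<times> int" where
  "walk xi i \<omega> = (int (card {k. k < i \<and> xi k \<omega>}), int (card {k. k < i \<and> \<not> xi k \<omega>}))"

end

theory Submission
  imports Defs "HOL-Number_Theory.Cong" "HOL-Real_Asymp.Real_Asymp"
begin

text \<open>
  A point (x, y) with positive coordinates is visible iff no prime p satisfies both p^b1 dvd x and
  p^b2 dvd y.  Restricting this condition to primes p at most N makes it periodic in the time i and in
  the positions, and its mean over a period is, by the Chinese remainder theorem, the partial Euler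
  product.  A prime q > N can only matter when q divides both i and x, which has mean
  frequency at most the sum of 1/q^2 over q > N, hence at most 1/N.

  Both frequencies are controlled by one estimate.  If h = F(x+1) - F(x) with F bounded by K and B is
  binomial with parameters n and a, then the identity
  E[F(B_n + 1) - F(B_n)] = E[F(B_(n+1)) (B_(n+1) - (n+1) a)] / ((n+1) a (1-a))
  gives an error bound K / sqrt((n+1) a (1-a)) for E[h(x + B_n)], uniformly in x and with no
  dependence on the period of h beyond K.  Hence the centred summands are weakly correlated, and a
  second moment argument along the times k^8 yields almost sure convergence.
\<close>

section \<open>Bernstein sums\<close>

text \<open>The obstacle is the unbounded set of primes: at time i even primes of size comparable to
  i matter, so no fixed period serves and an equidistribution bound that worsens with the modulus
  would not suffice. The way out is that the partial sums of a centred indicator of one residue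
  class modulo d are bounded by 1, whatever d is. A prime dividing both coordinates divides their
  sum i, so at time i only O(log i) large primes compete and K grows at most logarithmically; this
  is where all factors \<open>1 + ln (real j)\<close> come from. Positions at two times i < j are
  far from independent, but the steps between them are fresh, and averaging over these alone yields
  correlations of order (j - i)^(-1/2). Second moments of the partial sums are then O(n^(3/2)
  log(n)^2), less than n^2 by enough for a polynomial subsequence. With r walks, the indicators are
  replaced by their mean one walk at a time, so that each centred factor is multiplied by a bounded
  weight that depends only on the other walks.\<close>

text \<open>Conditioning on the last trial, that is, Pascal's rule. It drives the induction that
  identifies the law of \<open>ones\<close>.\<close>

lemma sum_Bernstein_Suc:
  "(\<Sum>k\<le>Suc n. Bernstein (Suc n) k a * f k) =
     a * (\<Sum>k\<le>n. Bernstein n k a * f (Suc k)) + (1 - a) * (\<Sum>k\<le>n. Bernstein n k a * f k)"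
proof -
  have 1: "Bernstein (Suc n) (Suc k) a = a * Bernstein n k a + (1 - a) * Bernstein n (Suc k) a" if "k \<le> n" for k
  proof (cases "k = n")
    case True
    then show ?thesis by (simp add: Bernstein_def)
  next
    case False
    then have "n - k = Suc (n - Suc k)" using that by simp
    then show ?thesis by (simp add: Bernstein_def algebra_simps)
  qed
  have "(\<Sum>k\<le>Suc n. Bernstein (Suc n) k a * f k)
      = Bernstein (Suc n) 0 a * f 0 + (\<Sum>k\<le>n. Bernstein (Suc n) (Suc k) a * f (Suc k))"
    by (rule sum.atMost_Suc_shift)
  also have "\<dots> = a * (\<Sum>k\<le>n. Bernstein n k a * f (Suc k)) + (1 - a) * (Bernstein n 0 a * f 0)
      + (1 - a) * (\<Sum>k\<le>n. Bernstein n (Suc k) a * f (Suc k))"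
    by (simp add: 1 sum.distrib sum_distrib_left distrib_right mult.assoc) (simp add: Bernstein_def)
  \<comment> \<open>The term k = n + 1 may be included for free, since n choose n + 1 is 0.\<close>
  also have "\<dots> = a * (\<Sum>k\<le>n. Bernstein n k a * f (Suc k)) + (1 - a) * (\<Sum>k\<le>Suc n. Bernstein n k a * f k)"
    by (simp only: sum.atMost_Suc_shift distrib_left add.assoc)
  also have "(\<Sum>k\<le>Suc n. Bernstein n k a * f k) = (\<Sum>k\<le>n. Bernstein n k a * f k)"
    by (simp add: Bernstein_def)
  finally show ?thesis .
qed

lemma sum_Bernstein_variance:
  "(\<Sum>k\<le>n. Bernstein n k a * (real k - real n * a)\<^sup>2) = real n * a * (1 - a)"
proof -
  have "(\<Sum>k\<le>n. Bernstein n k a * (real k - real n * a)\<^sup>2) =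
     (\<Sum>k\<le>n. real k * (real k - 1) * Bernstein n k a) + (1 - 2 * real n * a) * (\<Sum>k\<le>n. real k * Bernstein n k a)
      + (real n * a)\<^sup>2 * (\<Sum>k\<le>n. Bernstein n k a)"
    unfolding sum_distrib_left sum.distrib[symmetric]
    by (intro sum.cong refl) (simp add: algebra_simps power2_eq_square)
  also have "\<dots> = real n * a * (1 - a)"
    unfolding sum_kk_Bernstein sum_k_Bernstein sum_Bernstein by (simp add: algebra_simps power2_eq_square)
  finally show ?thesis .
qed

lemma sum_Bernstein_abs_deviation:
  assumes "0 < a" "a < 1"
  shows "(\<Sum>k\<le>n. Bernstein n k a * \<bar>real k - real n * a\<bar>) \<le> sqrt (real n * a * (1 - a))"
proof -
  define s where "s = sqrt (real n * a * (1 - a))"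
  have s2: "s\<^sup>2 = real n * a * (1 - a)" and s0: "s \<ge> 0"
    using assms by (simp_all add: s_def)
  show ?thesis
  proof (cases "n = 0")
    case True
    then show ?thesis by simp
  next
    case False
    then have sp: "s > 0" using assms by (simp add: s_def)
    have "(\<Sum>k\<le>n. Bernstein n k a * \<bar>real k - real n * a\<bar>)
       \<le> (\<Sum>k\<le>n. Bernstein n k a * (((real k - real n * a)\<^sup>2 / s + s) / 2))"
    proof (intro sum_mono mult_left_mono)
      fix k
      define z where "z = real k - real n * a"
      \<comment> \<open>The arithmetic-geometric mean inequality, balanced at the standard deviation
        \<open>s\<close>, replaces Cauchy-Schwarz; it requires \<open>s > 0\<close>, whence the
        separate case n = 0.\<close>
      have "0 \<le> (\<bar>z\<bar> - s)\<^sup>2" by simp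
      then have "2 * \<bar>z\<bar> * s \<le> z\<^sup>2 + s\<^sup>2" by (simp add: power2_eq_square algebra_simps)
      then show "\<bar>real k - real n * a\<bar> \<le> ((real k - real n * a)\<^sup>2 / s + s) / 2"
        using sp unfolding z_def[symmetric] by (simp add: field_simps power2_eq_square)
    qed (use assms in \<open>auto intro: Bernstein_nonneg\<close>)
    also have "\<dots> = ((\<Sum>k\<le>n. Bernstein n k a * (real k - real n * a)\<^sup>2) / s + s * (\<Sum>k\<le>n. Bernstein n k a)) / 2"
      by (simp only: sum_divide_distrib sum_distrib_left sum.distrib[symmetric])
        (intro sum.cong refl, simp add: field_simps)
    also have "\<dots> = (s\<^sup>2 / s + s) / 2"
      by (simp add: sum_Bernstein_variance s2)
    also have "\<dots> = s" using sp by (simp add: power2_eq_square)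
    finally show ?thesis by (simp add: s_def)
  qed
qed

text \<open>Summation by parts against binomial weights (a discrete Stein identity): the difference
  of \<open>f\<close> is traded for the centred variable, whose mean absolute value is only the
  square root of the prefactor on the left. The two absorption identities \<open>up\<close> and
  \<open>down\<close> move the weights from n to n + 1.\<close>

lemma sum_Bernstein_difference:
  "real (Suc n) * a * (1 - a) * (\<Sum>k\<le>n. Bernstein n k a * (f (Suc k) - f k)) =
     (\<Sum>k\<le>Suc n. Bernstein (Suc n) k a * (real k - real (Suc n) * a) * f k)"
proof -
  have up: "Bernstein (Suc n) (Suc k) a * real (Suc k) = real (Suc n) * a * Bernstein n k a" for k
  proof -
    have "real (Suc n choose Suc k) * real (Suc k) = real (Suc n) * real (n choose k)"
      using Suc_times_binomial_eq[of n k] by (metis of_nat_mult mult.commute)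
    moreover have "Bernstein (Suc n) (Suc k) a * real (Suc k) =
        (real (Suc n choose Suc k) * real (Suc k)) * (a * a ^ k * (1 - a) ^ (n - k))"
      by (simp add: Bernstein_def del: binomial_Suc_Suc of_nat_Suc)
    ultimately show ?thesis by (simp add: Bernstein_def del: binomial_Suc_Suc of_nat_Suc)
  qed
  have down: "Bernstein (Suc n) k a * real (Suc n - k) = real (Suc n) * (1 - a) * Bernstein n k a"
    if "k \<le> n" for k
  proof -
    have "real (Suc n choose k) * real (Suc n - k) = real (Suc n) * real (n choose k)"
      using binomial_absorb_comp[of "Suc n" k] by (metis diff_Suc_1 of_nat_mult mult.commute)
    moreover have "Suc n - k = Suc (n - k)" using that by simp
    moreover have "Bernstein (Suc n) k a * real (Suc n - k) =
        (real (Suc n choose k) * real (Suc n - k)) * (a ^ k * (1 - a) ^ (Suc n - k))"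
      by (simp add: Bernstein_def)
    ultimately show ?thesis by (simp only: Bernstein_def power_Suc mult_ac)
  qed
  \<comment> \<open>Uses k - (n + 1) a = (1 - a) k - a (n + 1 - k), which matches the two absorption
    identities.\<close>
  have "(\<Sum>k\<le>Suc n. Bernstein (Suc n) k a * (real k - real (Suc n) * a) * f k) =
     (1 - a) * (\<Sum>k\<le>Suc n. Bernstein (Suc n) k a * real k * f k)
     - a * (\<Sum>k\<le>Suc n. Bernstein (Suc n) k a * real (Suc n - k) * f k)"
    unfolding sum_distrib_left sum_subtractf[symmetric]
    by (intro sum.cong refl) (simp add: of_nat_diff algebra_simps)
  also have "(\<Sum>k\<le>Suc n. Bernstein (Suc n) k a * real k * f k) =
      real (Suc n) * a * (\<Sum>k\<le>n. Bernstein n k a * f (Suc k))"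
    unfolding sum.atMost_Suc_shift up by (simp add: sum_distrib_left algebra_simps)
  also have "(\<Sum>k\<le>Suc n. Bernstein (Suc n) k a * real (Suc n - k) * f k) =
      real (Suc n) * (1 - a) * (\<Sum>k\<le>n. Bernstein n k a * f k)"
  proof -
    have "(\<Sum>k\<le>Suc n. Bernstein (Suc n) k a * real (Suc n - k) * f k) =
       (\<Sum>k\<le>n. Bernstein (Suc n) k a * real (Suc n - k) * f k)" by simp
    also have "\<dots> = (\<Sum>k\<le>n. real (Suc n) * (1 - a) * Bernstein n k a * f k)"
      by (intro sum.cong refl) (simp only: atMost_iff down)
    finally show ?thesis by (simp add: sum_distrib_left algebra_simps)
  qed
  finally show ?thesis
    by (simp add: sum_subtractf algebra_simps)
qed

lemma sum_Bernstein_difference_bound: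
  assumes a: "0 < a" "a < 1" and K: "\<And>k. \<bar>f k\<bar> \<le> K"
  shows "\<bar>\<Sum>k\<le>n. Bernstein n k a * (f (Suc k) - f k)\<bar> \<le> K / sqrt (real (Suc n) * a * (1 - a))"
proof -
  define v where "v = real (Suc n) * a * (1 - a)"
  have v: "v > 0" using a by (simp add: v_def)
  have K0: "K \<ge> 0" using K[of 0] by linarith
  have "v * \<bar>\<Sum>k\<le>n. Bernstein n k a * (f (Suc k) - f k)\<bar> =
      \<bar>\<Sum>k\<le>Suc n. Bernstein (Suc n) k a * (real k - real (Suc n) * a) * f k\<bar>"
    unfolding sum_Bernstein_difference[symmetric] v_def[symmetric] using v by (simp add: abs_mult)
  also have "\<dots> \<le> (\<Sum>k\<le>Suc n. \<bar>Bernstein (Suc n) k a * (real k - real (Suc n) * a) * f k\<bar>)"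
    by (rule sum_abs)
  also have "\<dots> \<le> (\<Sum>k\<le>Suc n. K * (Bernstein (Suc n) k a * \<bar>real k - real (Suc n) * a\<bar>))"
  proof (intro sum_mono)
    fix k
    have "\<bar>Bernstein (Suc n) k a * (real k - real (Suc n) * a) * f k\<bar> =
       \<bar>f k\<bar> * (Bernstein (Suc n) k a * \<bar>real k - real (Suc n) * a\<bar>)"
      using a by (simp add: abs_mult Bernstein_nonneg)
    also have "\<dots> \<le> K * (Bernstein (Suc n) k a * \<bar>real k - real (Suc n) * a\<bar>)"
      using a K by (intro mult_right_mono mult_nonneg_nonneg Bernstein_nonneg) auto
    finally show "\<bar>Bernstein (Suc n) k a * (real k - real (Suc n) * a) * f k\<bar> \<le> \<dots>" .
  qed
  also have "\<dots> = K * (\<Sum>k\<le>Suc n. Bernstein (Suc n) k a * \<bar>real k - real (Suc n) * a\<bar>)"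
    by (rule sum_distrib_left[symmetric])
  also have "\<dots> \<le> K * sqrt v"
    unfolding v_def using a K0 by (intro mult_left_mono sum_Bernstein_abs_deviation)
  finally have "\<bar>\<Sum>k\<le>n. Bernstein n k a * (f (Suc k) - f k)\<bar> \<le> K * sqrt v / v"
    using v by (simp add: field_simps)
  also have "K * sqrt v / v = K / sqrt v"
    using v by (simp add: field_simps)
  finally show ?thesis by (simp add: v_def)
qed

section \<open>Visibility and prime powers\<close>

text \<open>Dividing x by p^b1 and y by p^b2 divides both sides of the curve equation by p^(b1 b2).
  The smaller point therefore lies on every admissible curve through (x, y), whichever coefficients
  are chosen.\<close>

lemma not_b_visible_if_prime_power_dvd:
  assumes "p > 1" "b1 > 0" "b2 > 0" "x > 0" "y > 0" "p ^ b1 dvd x" "p ^ b2 dvd y"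
  shows "\<not> b_visible b1 b2 (int x, int y)"
proof
  assume "b_visible b1 b2 (int x, int y)"
  then obtain a1 a2 :: rat where
    P: "real_of_rat a1 * real y ^ b1 = real_of_rat a2 * real x ^ b2" and
    no: "\<And>R. R \<noteq> (int x, int y) \<Longrightarrow> R \<noteq> (0, 0) \<Longrightarrow> in_box (int x, int y) (0, 0) R \<Longrightarrow>
       \<not> bcurve b1 b2 a1 a2 (0, 0) (real_of_int (fst R), real_of_int (snd R))"
    unfolding b_visible_def b_visible_from_def by (auto simp: bcurve_def)
  obtain u v where u: "x = p ^ b1 * u" and v: "y = p ^ b2 * v"
    using assms by (auto elim!: dvdE)
  have uv: "u > 0" "v > 0" using u v assms by auto
  have "p ^ b1 > 1" "p ^ b2 > 1" using assms by (auto intro: one_less_power simp del: One_nat_def)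
  then have lt: "u < x" "v < y" using u v uv by auto
  have "real p ^ (b1 * b2) * (real_of_rat a1 * real v ^ b1) = real p ^ (b1 * b2) * (real_of_rat a2 * real u ^ b2)"
    using P unfolding u v by (simp add: power_mult_distrib power_mult[symmetric] algebra_simps)
  then have "real_of_rat a1 * real v ^ b1 = real_of_rat a2 * real u ^ b2"
    using assms by simp
  moreover have "in_box (int x, int y) (0, 0) (int u, int v)"
    using lt by (simp add: in_box_def)
  ultimately show False
    using no[of "(int u, int v)"] lt uv by (simp add: bcurve_def)
qed

text \<open>Some prime p has larger valuation in x than in u. Comparing valuations gives b2 (v(x) -
  v(u)) = b1 (v(y) - v(v)), so by coprimality these positive differences are multiples of b1 and b2
  respectively.\<close>

lemma prime_power_dvd_of_power_eq:
  fixes x y u v :: nat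
  assumes b: "b1 > 0" "b2 > 0" "coprime b1 b2" and pos: "x > 0" "y > 0" "u > 0" "v > 0"
    and eq: "x ^ b2 * v ^ b1 = y ^ b1 * u ^ b2" and "\<not> x dvd u"
  shows "\<exists>p. prime p \<and> p ^ b1 dvd x \<and> p ^ b2 dvd y"
proof -
  obtain p where p: "prime p" and m: "multiplicity p u < multiplicity p x"
    using multiplicity_le_imp_dvd[of x u] \<open>x > 0\<close> \<open>\<not> x dvd u\<close> by (metis not_le less_numeral_extra(3))
  define dx where "dx = multiplicity p x - multiplicity p u"
  have "multiplicity p (x ^ b2 * v ^ b1) = multiplicity p (y ^ b1 * u ^ b2)" using eq by simp
  then have e: "b2 * multiplicity p x + b1 * multiplicity p v = b1 * multiplicity p y + b2 * multiplicity p u"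
    using p pos by (simp add: prime_elem_multiplicity_mult_distrib prime_elem_multiplicity_power_distrib)
  have "b2 * multiplicity p x > b2 * multiplicity p u" using m b by simp
  then have my: "multiplicity p v < multiplicity p y" using e b
    by (metis add_less_cancel_right nat_add_left_cancel_less add.commute nat_mult_less_cancel1)
  define dy where "dy = multiplicity p y - multiplicity p v"
  have d: "multiplicity p x = multiplicity p u + dx" "multiplicity p y = multiplicity p v + dy"
    "dx > 0" "dy > 0"
    using m my by (simp_all add: dx_def dy_def)
  have "b2 * dx = b1 * dy" using e unfolding d by (simp add: algebra_simps)
  then have "b1 dvd b2 * dx" "b2 dvd b1 * dy" by (simp_all, metis dvd_triv_left)
  then have "b1 dvd dx" "b2 dvd dy" using b
    by (simp_all add: coprime_dvd_mult_right_iff coprime_commute)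
  then have "b1 \<le> dx" "b2 \<le> dy" using d by (simp_all add: dvd_imp_le)
  then have "b1 \<le> multiplicity p x" "b2 \<le> multiplicity p y" using d by simp_all
  then show ?thesis using p by (auto intro: multiplicity_dvd')
qed

lemma b_visible_if_no_prime_power_dvd:
  assumes b: "b1 > 0" "b2 > 0" "coprime b1 b2" and xy: "x > 0" "y > 0"
    and no: "\<not> (\<exists>p. prime p \<and> p ^ b1 dvd x \<and> p ^ b2 dvd y)"
  shows "b_visible b1 b2 (int x, int y)"
proof -
  \<comment> \<open>The coefficients x^b2 and y^b1 are read off by requiring the curve to pass
    through (x, y).\<close>
  have "\<not> bcurve b1 b2 (of_nat x ^ b2) (of_nat y ^ b1) (0, 0) (real_of_int (fst R), real_of_int (snd R))"
    if R: "R \<noteq> (int x, int y)" "R \<noteq> (0, 0)" "in_box (int x, int y) (0, 0) R" for R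
  proof
    assume c: "bcurve b1 b2 (of_nat x ^ b2) (of_nat y ^ b1) (0, 0) (real_of_int (fst R), real_of_int (snd R))"
    obtain u v where uv: "R = (int u, int v)" "u \<le> x" "v \<le> y"
    proof -
      have "0 \<le> fst R" "0 \<le> snd R" "fst R \<le> int x" "snd R \<le> int y" using R(3) by (auto simp: in_box_def)
      then show ?thesis
        by (intro that[of "nat (fst R)" "nat (snd R)"]) auto
    qed
    have "real (x ^ b2 * v ^ b1) = real (y ^ b1 * u ^ b2)"
      using c by (simp add: uv bcurve_def of_rat_mult of_rat_power)
    then have eq: "x ^ b2 * v ^ b1 = y ^ b1 * u ^ b2" using of_nat_eq_iff by blast
    have "u > 0" "v > 0"
    \<comment> \<open>Both coefficients are nonzero, so the curve meets the axes only at the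
      origin.\<close>
    proof -
      have "u = 0 \<longleftrightarrow> v = 0"
        using eq xy b by (metis mult_eq_0_iff not_gr_zero power_eq_0_iff)
      then show "u > 0" "v > 0" using R(2) uv by auto
    qed
    moreover have "\<not> x dvd u"
    proof
      assume "x dvd u"
      then have "u = x" using uv \<open>u > 0\<close> by (simp add: dvd_imp_le le_antisym)
      then have "v ^ b1 = y ^ b1" using eq xy by simp
      then have "v = y" using b power_eq_imp_eq_base[of v b1 y] by simp
      then show False using R(1) uv \<open>u = x\<close> by simp
    qed
    ultimately show False
      using prime_power_dvd_of_power_eq[OF b xy _ _ eq] no by blast
  qed
  moreover have "(of_nat x ^ b2, of_nat y ^ b1) \<noteq> (0 :: rat, 0 :: rat)" using xy by simp
  ultimately show ?thesis
    unfolding b_visible_def b_visible_from_def using xy b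
    by (intro conjI exI[of _ "of_nat x ^ b2"] exI[of _ "of_nat y ^ b1"])
      (auto simp: bcurve_def of_rat_mult of_rat_power zero_power)
qed

lemma b_visible_iff:
  assumes "b1 > 0" "b2 > 0" "coprime b1 b2" "x > 0" "y > 0"
  shows "b_visible b1 b2 (int x, int y) \<longleftrightarrow> \<not> (\<exists>p. prime p \<and> p ^ b1 dvd x \<and> p ^ b2 dvd y)"
  using not_b_visible_if_prime_power_dvd b_visible_if_no_prime_power_dvd assms prime_gt_1_nat by metis

section \<open>Periodic functions\<close>

text \<open>Whole periods cancel, and within a period both the partial sum and its linear prediction
  lie between 0 and the sum over a period. The bound is this sum rather than the period length,
  which makes it uniform in d for a single residue class.\<close>

lemma periodic_partial_sum_bound:
  fixes f :: "nat \<Rightarrow> real"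
  assumes d: "d > 0" and per: "\<And>x. f (x + d) = f x" and nonneg: "\<And>x. 0 \<le> f x"
  shows "\<bar>\<Sum>l<k. f l - (\<Sum>l<d. f l) / real d\<bar> \<le> (\<Sum>l<d. f l)"
proof -
  define S where "S = (\<Sum>l<d. f l)"
  have S0: "S \<ge> 0" unfolding S_def by (intro sum_nonneg nonneg)
  have "\<bar>\<Sum>l<k. f l - S / real d\<bar> \<le> S"
  proof (induction k rule: less_induct)
    case (less k)
    show ?case
    proof (cases "k < d")
      case True
      have "(\<Sum>l<k. f l) \<le> S" unfolding S_def using True nonneg by (intro sum_mono2) auto
      moreover have "0 \<le> (\<Sum>l<k. f l)" by (intro sum_nonneg nonneg)
      moreover have "real k * (S / real d) \<le> real d * (S / real d)"
        using True S0 by (intro mult_right_mono) auto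
      moreover have "real d * (S / real d) = S" using d by simp
      moreover have "0 \<le> real k * (S / real d)" using S0 by simp
      ultimately show ?thesis unfolding sum_subtractf sum_constant card_lessThan by linarith
    next
      case False
      then obtain j where k: "k = d + j" using le_Suc_ex not_less by blast
      have "(\<Sum>l<k. f l - S / real d) = (\<Sum>l<d. f l - S / real d) + (\<Sum>l<j. f (l + d) - S / real d)"
        unfolding k by (induction j) (simp_all add: add.commute)
      also have "(\<Sum>l<d. f l - S / real d) = 0"
        using d by (simp add: sum_subtractf S_def)
      finally have "(\<Sum>l<k. f l - S / real d) = (\<Sum>l<j. f l - S / real d)" by (simp add: per)
      then show ?thesis using less[of j] k d by simp
    qed
  qed
  then show ?thesis by (simp add: S_def)
qed

lemma periodic_average_tendsto:
  fixes f :: "nat \<Rightarrow> real"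
  assumes d: "d > 0" and per: "\<And>x. f (x + d) = f x" and nonneg: "\<And>x. 0 \<le> f x"
  shows "(\<lambda>n. (\<Sum>i = 1..n. f i) / real n) \<longlonglongrightarrow> (\<Sum>l<d. f l) / real d"
proof -
  define S where "S = (\<Sum>l<d. f l)"
  define H where "H = (\<lambda>k. \<Sum>l<k. f l - S / real d)"
  have H: "\<bar>H k\<bar> \<le> S" for k
    unfolding H_def S_def by (rule periodic_partial_sum_bound assms)+
  \<comment> \<open>Averages start at time 1 whereas \<open>H\<close> starts at 0; hence the index
    \<open>Suc n\<close> and the subtracted term for 0.\<close>
  have eq: "(\<Sum>i = 1..n. f i) / real n - S / real d = (H (Suc n) - (f 0 - S / real d)) / real n" if "n > 0" for n
  proof -
    have "H (Suc n) = (f 0 - S / real d) + (\<Sum>i = 1..n. f i - S / real d)"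
      unfolding H_def by (simp only: sum.lessThan_Suc_shift) (simp add: sum.atLeast1_atMost_eq)
    then show ?thesis using that by (simp add: sum_subtractf field_simps)
  qed
  have "(\<lambda>n. (\<Sum>i = 1..n. f i) / real n - S / real d) \<longlonglongrightarrow> 0"
  proof (rule Lim_null_comparison)
    show "\<forall>\<^sub>F n in sequentially. norm ((\<Sum>i = 1..n. f i) / real n - S / real d)
        \<le> (S + \<bar>f 0 - S / real d\<bar>) / real n"
      using eventually_gt_at_top[of 0]
    proof eventually_elim
      case (elim n)
      have "\<bar>H (Suc n) - (f 0 - S / real d)\<bar> \<le> S + \<bar>f 0 - S / real d\<bar>" using H[of "Suc n"] by linarith
      then show ?case unfolding eq[OF elim] using elim by (simp add: divide_right_mono)
    qed
    show "(\<lambda>n. (S + \<bar>f 0 - S / real d\<bar>) / real n) \<longlonglongrightarrow> 0"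
      by (rule lim_const_over_n)
  qed
  then show ?thesis unfolding S_def[symmetric] by (rule LIM_zero_cancel)
qed

lemma sum_mult_coprime_periods:
  fixes f g :: "nat \<Rightarrow> real"
  assumes ab: "coprime a b" "a > 0" "b > 0"
    and f: "\<And>x. f (x mod a) = f x" and g: "\<And>x. g (x mod b) = g x"
  shows "(\<Sum>x<a * b. f x * g x) = (\<Sum>x<a. f x) * (\<Sum>x<b. g x)"
proof -
  have inj: "inj_on (\<lambda>x. (x mod a, x mod b)) {..<a * b}"
  proof (rule inj_onI)
    fix x y assume xy: "x \<in> {..<a * b}" "y \<in> {..<a * b}" "(x mod a, x mod b) = (y mod a, y mod b)"
    then have "[x = y] (mod a)" "[x = y] (mod b)" by (auto simp: cong_def)
    then have "[x = y] (mod a * b)" using ab by (simp add: coprime_cong_mult_nat)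
    then show "x = y" using xy by (simp add: cong_def)
  qed
  \<comment> \<open>Surjectivity in the Chinese remainder theorem follows from injectivity by
    counting.\<close>
  have "(\<lambda>x. (x mod a, x mod b)) ` {..<a * b} = {..<a} \<times> {..<b}"
    using ab card_image[OF inj] by (intro card_subset_eq) auto
  with inj have "bij_betw (\<lambda>x. (x mod a, x mod b)) {..<a * b} ({..<a} \<times> {..<b})"
    by (simp add: bij_betw_def)
  then have "(\<Sum>x<a * b. (\<lambda>(u, v). f u * g v) (x mod a, x mod b)) = (\<Sum>(u, v)\<in>{..<a} \<times> {..<b}. f u * g v)"
    by (rule sum.reindex_bij_betw)
  then show ?thesis by (simp add: f g sum_product sum.cartesian_product)
qed

lemma sum_prod_coprime_periods:
  fixes f :: "'i \<Rightarrow> nat \<Rightarrow> real"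
  assumes "finite P" and pos: "\<And>p. p \<in> P \<Longrightarrow> d p > 0"
    and cop: "\<And>p q. p \<in> P \<Longrightarrow> q \<in> P \<Longrightarrow> p \<noteq> q \<Longrightarrow> coprime (d p) (d q)"
    and per: "\<And>p x. p \<in> P \<Longrightarrow> f p (x mod d p) = f p x"
  shows "(\<Sum>x<(\<Prod>p\<in>P. d p). \<Prod>p\<in>P. f p x) = (\<Prod>p\<in>P. \<Sum>x<d p. f p x)"
  using assms
proof (induction P rule: finite_induct)
  case empty
  then show ?case by simp
next
  case (insert q P)
  have "(\<Sum>x<d q * (\<Prod>p\<in>P. d p). f q x * (\<Prod>p\<in>P. f p x)) = (\<Sum>x<d q. f q x) * (\<Sum>x<(\<Prod>p\<in>P. d p). \<Prod>p\<in>P. f p x)"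
  proof (rule sum_mult_coprime_periods)
    show "coprime (d q) (\<Prod>p\<in>P. d p)"
      using insert by (intro prod_coprime_right) (metis insertCI)
    show "d q > 0" "(\<Prod>p\<in>P. d p) > 0" using insert by (auto intro: prod_pos)
    show "f q (x mod d q) = f q x" for x using insert by simp
    show "(\<Prod>p\<in>P. f p (x mod (\<Prod>p\<in>P. d p))) = (\<Prod>p\<in>P. f p x)" for x
    proof (intro prod.cong refl)
      fix p assume p: "p \<in> P"
      have "f p (x mod (\<Prod>p\<in>P. d p)) = f p (x mod (\<Prod>p\<in>P. d p) mod d p)"
        using insert.prems(3) p by simp
      also have "\<dots> = f p (x mod d p)" using p insert(1) by (simp add: mod_mod_cancel dvd_prodI)
      also have "\<dots> = f p x" using insert.prems(3) p by simp
      finally show "f p (x mod (\<Prod>p\<in>P. d p)) = f p x" .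
    qed
  qed
  then show ?case using insert by simp
qed

text \<open>Distinct primes dividing n have a product dividing n, so 2^(card A) is at most n. The
  summand 1 matches the growth condition imposed on summands at time 1, where the logarithm
  vanishes.\<close>

lemma card_prime_divisors_le_ln:
  assumes "n > 0" "finite A" "\<And>p. p \<in> A \<Longrightarrow> prime p \<and> p dvd n"
  shows "real (card A) \<le> 2 * (1 + ln (real n))"
proof -
  have "(\<Prod>p\<in>A. p) dvd n"
    using assms(2,3)
  proof (induction A rule: finite_induct)
    case (insert q A)
    have "coprime q (\<Prod>p\<in>A. p)"
      using insert by (intro prod_coprime_right) (metis insertCI primes_coprime)
    then show ?case using insert by (simp add: divides_mult)
  qed simp
  moreover have "(\<Prod>p\<in>A. 2) \<le> (\<Prod>p\<in>A. p)"
    using assms by (intro prod_mono) (auto dest: prime_ge_2_nat)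
  ultimately have "(2::nat) ^ card A \<le> n" using assms(1) by (auto dest: dvd_imp_le)
  then have "real (2 ^ card A) \<le> real n" by (rule of_nat_mono)
  then have "ln (2 ^ card A) \<le> ln (real n)" using assms by (subst ln_le_cancel_iff) auto
  then have "real (card A) * ln 2 \<le> ln (real n)" by (simp add: ln_realpow)
  \<comment> \<open>ln 2 is at least 1/2, because ln (1/2) is at most 1/2 - 1; this is the origin of
    the factor 2.\<close>
  moreover have "real (card A) * (1/2) \<le> real (card A) * ln 2"
    using ln_le_minus_one[of "1 / 2"] by (intro mult_left_mono) (auto simp: ln_div)
  ultimately show ?thesis by simp
qed

section \<open>A strong law for weakly correlated variables\<close>

lemma sum_inverse_sqrt_le: "(\<Sum>d = 1..n. 1 / sqrt (real d)) \<le> 2 * sqrt (real n)"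
proof (induction n)
  case (Suc n)
  have "(\<Sum>d = 1..Suc n. 1 / sqrt (real d)) \<le> 2 * sqrt (real n) + 1 / sqrt (real (Suc n))"
    using Suc by simp
  also have "\<dots> \<le> 2 * sqrt (real (Suc n))"
  proof -
    define s t where "s = sqrt (real n)" and "t = sqrt (real (Suc n))"
    have st: "t > 0" "s\<^sup>2 + 1 = t\<^sup>2" by (simp_all add: s_def t_def)
    have "0 \<le> (t - s)\<^sup>2" by simp
    then have "2 * s * t + 1 \<le> 2 * t\<^sup>2" using st by (simp add: power2_eq_square algebra_simps)
    then show ?thesis unfolding s_def[symmetric] t_def[symmetric] using st
      by (simp add: field_simps power2_eq_square)
  qed
  finally show ?case .
qed simp

text \<open>Between consecutive eighth powers there are O(k^7) times, and each summand is O(log k),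
  so the partial sums move by o(k^8) there.\<close>

lemma average_tendsto_0_of_subsequence:
  fixes q :: "nat \<Rightarrow> real"
  assumes bound: "\<And>j. j \<ge> 1 \<Longrightarrow> \<bar>q j\<bar> \<le> c * (1 + ln (real j))" and c: "c \<ge> 0"
    and sub: "(\<lambda>k. (\<Sum>j = 1..k ^ 8. q j) / real (k ^ 8)) \<longlonglongrightarrow> 0"
  shows "(\<lambda>n. (\<Sum>j = 1..n. q j) / real n) \<longlonglongrightarrow> 0"
proof -
  define T where "T = (\<lambda>n. \<Sum>j = 1..n. q j)"
  define \<kappa> where "\<kappa> = (\<lambda>n::nat. nat \<lfloor>root 8 (real n)\<rfloor>)"
  have \<kappa>_le: "\<kappa> n ^ 8 \<le> n" for n
  proof -
    have "real (\<kappa> n) \<le> root 8 (real n)" by (simp add: \<kappa>_def)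
    then have "real (\<kappa> n) ^ 8 \<le> root 8 (real n) ^ 8" by (intro power_mono) auto
    then have "real (\<kappa> n ^ 8) \<le> real n" by simp
    then show ?thesis using of_nat_le_iff by blast
  qed
  have \<kappa>_gt: "n < Suc (\<kappa> n) ^ 8" for n
  proof -
    have "root 8 (real n) < real (Suc (\<kappa> n))" unfolding \<kappa>_def
      by (smt (verit) of_nat_Suc of_nat_nat real_of_int_floor_add_one_gt real_root_ge_zero of_nat_0_le_iff zero_le_floor)
    then have "root 8 (real n) ^ 8 < real (Suc (\<kappa> n)) ^ 8" by (intro power_strict_mono) auto
    then have "real n < real (Suc (\<kappa> n) ^ 8)" by simp
    then show ?thesis using of_nat_less_iff by blast
  qed
  have \<kappa>_lim: "filterlim \<kappa> at_top sequentially"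
    unfolding filterlim_at_top
  proof
    fix K
    show "\<forall>\<^sub>F n in sequentially. K \<le> \<kappa> n"
      using eventually_ge_at_top[of "K ^ 8"]
    proof eventually_elim
      case (elim n)
      then have "K ^ 8 < Suc (\<kappa> n) ^ 8" using \<kappa>_gt[of n] by simp
      then have "K < Suc (\<kappa> n)" by (rule power_less_imp_less_base) simp
      then show ?case by simp
    qed
  qed
  \<comment> \<open>The largest possible change of the partial sums before the next eighth power,
    relative to k^8.\<close>
  define e where "e = (\<lambda>k::nat. ((real k + 1) ^ 8 - real k ^ 8) * (c * (1 + 8 * ln (real k + 1))) / real k ^ 8)"
  have e: "e \<longlonglongrightarrow> 0" unfolding e_def by real_asymp
  have diff: "\<bar>T n - T (\<kappa> n ^ 8)\<bar> \<le> ((real (\<kappa> n) + 1) ^ 8 - real (\<kappa> n) ^ 8) * (c * (1 + 8 * ln (real (\<kappa> n) + 1)))" for n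
  proof -
    define k where "k = \<kappa> n"
    have "T n = T (k ^ 8) + (\<Sum>j = k ^ 8 + 1..n. q j)"
    proof -
      obtain p where "n = k ^ 8 + p" using \<kappa>_le[of n] le_Suc_ex unfolding k_def by blast
      then show ?thesis unfolding T_def using sum.ub_add_nat[of 1 "k ^ 8" q p] by simp
    qed
    then have "\<bar>T n - T (k ^ 8)\<bar> \<le> (\<Sum>j = k ^ 8 + 1..n. \<bar>q j\<bar>)" by simp
    also have "\<dots> \<le> (\<Sum>j = k ^ 8 + 1..n. c * (1 + 8 * ln (real k + 1)))"
    proof (intro sum_mono)
      fix j assume j: "j \<in> {k ^ 8 + 1..n}"
      then have "j \<le> Suc k ^ 8" "j \<ge> 1" using \<kappa>_gt[of n] by (auto simp: k_def)
      then have "real j \<le> real (Suc k ^ 8)" using of_nat_le_iff by blast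
      then have "ln (real j) \<le> ln ((real k + 1) ^ 8)" using \<open>j \<ge> 1\<close> by (simp add: add.commute)
      also have "\<dots> = 8 * ln (real k + 1)" by (simp add: ln_realpow)
      finally have "ln (real j) \<le> 8 * ln (real k + 1)" .
      then have "c * (1 + ln (real j)) \<le> c * (1 + 8 * ln (real k + 1))" using c by (intro mult_left_mono) auto
      then show "\<bar>q j\<bar> \<le> c * (1 + 8 * ln (real k + 1))" using bound[OF \<open>j \<ge> 1\<close>] by simp
    qed
    also have "\<dots> = (real n - real k ^ 8) * (c * (1 + 8 * ln (real k + 1)))"
      using \<kappa>_le[of n] by (simp add: k_def of_nat_diff)
    also have "\<dots> \<le> ((real k + 1) ^ 8 - real k ^ 8) * (c * (1 + 8 * ln (real k + 1)))"
    proof (intro mult_right_mono)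
      have "real n \<le> real (Suc k ^ 8)" using \<kappa>_gt[of n] unfolding k_def of_nat_le_iff by simp
      then show "real n - real k ^ 8 \<le> (real k + 1) ^ 8 - real k ^ 8" by (simp add: add.commute)
    qed (use c in simp)
    finally show ?thesis by (simp add: k_def)
  qed
  have "(\<lambda>n. T n / real n) \<longlonglongrightarrow> 0"
  proof (rule Lim_null_comparison)
    show "\<forall>\<^sub>F n in sequentially. norm (T n / real n) \<le> \<bar>T (\<kappa> n ^ 8) / real (\<kappa> n ^ 8)\<bar> + e (\<kappa> n)"
      \<comment> \<open>\<open>\<kappa> n\<close> must be at least 1, since
        \<open>\<kappa> n ^ 8\<close> becomes a denominator.\<close>
      using eventually_gt_at_top[of 0] \<kappa>_lim[unfolded filterlim_at_top, rule_format, of 1]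
    proof eventually_elim
      case (elim n)
      define D where "D = ((real (\<kappa> n) + 1) ^ 8 - real (\<kappa> n) ^ 8) * (c * (1 + 8 * ln (real (\<kappa> n) + 1)))"
      have kp: "real (\<kappa> n ^ 8) > 0" using elim by simp
      have D: "\<bar>T n\<bar> \<le> \<bar>T (\<kappa> n ^ 8)\<bar> + D" using diff[of n] unfolding D_def by linarith
      have "\<bar>T n / real n\<bar> = \<bar>T n\<bar> / real n" by simp
      also have "\<dots> \<le> (\<bar>T (\<kappa> n ^ 8)\<bar> + D) / real (\<kappa> n ^ 8)"
        using D \<kappa>_le[of n] kp elim by (intro frac_le) (auto simp flip: of_nat_power)
      also have "\<dots> = \<bar>T (\<kappa> n ^ 8) / real (\<kappa> n ^ 8)\<bar> + e (\<kappa> n)"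
        by (simp add: e_def D_def add_divide_distrib)
      finally show ?case by simp
    qed
    have "(\<lambda>n. \<bar>T (\<kappa> n ^ 8) / real (\<kappa> n ^ 8)\<bar>) \<longlonglongrightarrow> 0"
      using filterlim_compose[OF tendsto_rabs_zero[OF sub] \<kappa>_lim] by (simp add: T_def)
    from tendsto_add[OF this filterlim_compose[OF e \<kappa>_lim]]
    show "(\<lambda>n. \<bar>T (\<kappa> n ^ 8) / real (\<kappa> n ^ 8)\<bar> + e (\<kappa> n)) \<longlonglongrightarrow> 0" by simp
  qed
  then show ?thesis by (simp add: T_def)
qed

text \<open>The sum of the squares has finite expectation, so it is almost surely finite and its
  terms tend to 0. This replaces Chebyshev and Borel-Cantelli.\<close>

lemma (in prob_space) AE_tendsto_0_if_second_moments_summable: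
  fixes U :: "nat \<Rightarrow> 'a \<Rightarrow> real"
  assumes U: "\<And>k. integrable M (\<lambda>\<omega>. (U k \<omega>)\<^sup>2)"
    and le: "\<And>k. expectation (\<lambda>\<omega>. (U k \<omega>)\<^sup>2) \<le> b k" and b: "summable b"
  shows "AE \<omega> in M. (\<lambda>k. U k \<omega>) \<longlonglongrightarrow> 0"
proof -
  have b0: "0 \<le> b k" for k
    by (rule order_trans[OF _ le[of k]]) simp
  have [measurable]: "(\<lambda>\<omega>. (U k \<omega>)\<^sup>2) \<in> borel_measurable M" for k
    using U by (rule borel_measurable_integrable)
  have "(\<integral>\<^sup>+\<omega>. (\<Sum>k. ennreal ((U k \<omega>)\<^sup>2)) \<partial>M) = (\<Sum>k. \<integral>\<^sup>+\<omega>. ennreal ((U k \<omega>)\<^sup>2) \<partial>M)"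
    by (intro nn_integral_suminf) measurable
  also have "\<dots> = (\<Sum>k. ennreal (expectation (\<lambda>\<omega>. (U k \<omega>)\<^sup>2)))"
    using U by (simp add: nn_integral_eq_integral)
  also have "\<dots> \<le> (\<Sum>k. ennreal (b k))"
    using le by (intro suminf_le ennreal_leI) auto
  also have "\<dots> < \<infinity>"
    using b b0 by (simp add: suminf_ennreal2 less_top)
  finally have "AE \<omega> in M. (\<Sum>k. ennreal ((U k \<omega>)\<^sup>2)) \<noteq> \<infinity>"
    by (intro nn_integral_PInf_AE) auto
  then show ?thesis
  proof eventually_elim
    case (elim \<omega>)
    then have "summable (\<lambda>k. (U k \<omega>)\<^sup>2)"
      by (intro summable_suminf_not_top) auto
    then have "(\<lambda>k. (U k \<omega>)\<^sup>2) \<longlonglongrightarrow> 0" by (rule summable_LIMSEQ_zero)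
    then have "(\<lambda>k. sqrt ((U k \<omega>)\<^sup>2)) \<longlonglongrightarrow> sqrt 0" by (rule tendsto_real_sqrt)
    then show ?case by (simp add: tendsto_rabs_zero_iff)
  qed
qed

text \<open>Correlations of order d^(-1/2) at distance d add up to O(sqrt n) per summand, so the
  second moment of the n-th sum is O(n^(3/2) log(n)^2). Only an upper bound on correlations is asked
  for: negative ones merely help.\<close>

lemma (in prob_space) AE_average_tendsto_0_of_decorrelation:
  fixes Q :: "nat \<Rightarrow> 'a \<Rightarrow> real"
  assumes Q [measurable]: "\<And>j. random_variable borel (Q j)" and c: "c \<ge> 0"
    and bound: "\<And>j \<omega>. j \<ge> 1 \<Longrightarrow> \<omega> \<in> space M \<Longrightarrow> \<bar>Q j \<omega>\<bar> \<le> c * (1 + ln (real j))"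
    and corr: "\<And>i j. 1 \<le> i \<Longrightarrow> i < j \<Longrightarrow>
      expectation (\<lambda>\<omega>. Q i \<omega> * Q j \<omega>) \<le> c * (1 + ln (real j))\<^sup>2 / sqrt (real (j - i))"
  shows "AE \<omega> in M. (\<lambda>n. (\<Sum>j = 1..n. Q j \<omega>) / real n) \<longlonglongrightarrow> 0"
proof -
  define T where "T = (\<lambda>n \<omega>. \<Sum>j = 1..n. Q j \<omega>)"
  define L where "L = (\<lambda>n::nat. (1 + ln (real n))\<^sup>2)"
  \<comment> \<open>Per induction step, 4c comes from the doubled cross terms with
    \<open>sum_inverse_sqrt_le\<close>, and the square of c from the diagonal term.\<close>
  define C where "C = 4 * c + c\<^sup>2"
  have C0: "C \<ge> 0" using c by (simp add: C_def)
  have [measurable]: "random_variable borel (T n)" for n unfolding T_def by measurable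
  have Q_int: "integrable M (\<lambda>\<omega>. Q i \<omega> * Q j \<omega>)" if "i \<ge> 1" "j \<ge> 1" for i j
  proof (rule integrable_const_bound)
    show "AE \<omega> in M. norm (Q i \<omega> * Q j \<omega>) \<le> (c * (1 + ln (real i))) * (c * (1 + ln (real j)))"
    proof (rule AE_I2)
      fix \<omega> assume "\<omega> \<in> space M"
      then show "norm (Q i \<omega> * Q j \<omega>) \<le> (c * (1 + ln (real i))) * (c * (1 + ln (real j)))"
        unfolding real_norm_def abs_mult
        using bound that c by (intro mult_mono) auto
    qed
  qed simp
  have T_int: "integrable M (\<lambda>\<omega>. (T n \<omega>)\<^sup>2)" for n
    unfolding T_def power2_eq_square sum_product
    by (intro Bochner_Integration.integrable_sum Q_int) auto
  have moment: "expectation (\<lambda>\<omega>. (T n \<omega>)\<^sup>2) \<le> C * L n * real n * sqrt (real n)" for n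
  proof (induction n)
    case 0
    then show ?case by (simp add: T_def)
  next
    case (Suc n)
    define N where "N = Suc n"
    have N1: "N \<ge> 1" by (simp add: N_def)
    have L0: "L N \<ge> 0" by (simp add: L_def)
    have TQ: "(\<lambda>\<omega>. (T N \<omega>)\<^sup>2) = (\<lambda>\<omega>. (T n \<omega>)\<^sup>2 + 2 * (\<Sum>i = 1..n. Q i \<omega> * Q N \<omega>) + Q N \<omega> * Q N \<omega>)"
      by (rule ext) (simp add: T_def N_def power2_eq_square algebra_simps sum_distrib_left sum_distrib_right)
    have "expectation (\<lambda>\<omega>. (T N \<omega>)\<^sup>2) = expectation (\<lambda>\<omega>. (T n \<omega>)\<^sup>2)
        + 2 * (\<Sum>i = 1..n. expectation (\<lambda>\<omega>. Q i \<omega> * Q N \<omega>)) + expectation (\<lambda>\<omega>. Q N \<omega> * Q N \<omega>)"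
    proof -
      have "integrable M (\<lambda>\<omega>. \<Sum>i = 1..n. Q i \<omega> * Q N \<omega>)"
        using N1 by (intro Bochner_Integration.integrable_sum Q_int) auto
      moreover have "expectation (\<lambda>\<omega>. \<Sum>i = 1..n. Q i \<omega> * Q N \<omega>) = (\<Sum>i = 1..n. expectation (\<lambda>\<omega>. Q i \<omega> * Q N \<omega>))"
        using N1 by (intro Bochner_Integration.integral_sum Q_int) auto
      ultimately show ?thesis
        unfolding TQ using T_int[of n] Q_int[OF N1 N1] by simp
    qed
    also have "\<dots> \<le> C * L N * real n * sqrt (real N) + 2 * (c * L N * (2 * sqrt (real N))) + c\<^sup>2 * L N * sqrt (real N)"
    proof (intro add_mono mult_left_mono)
      have "L n \<le> L N"
      proof (cases "n = 0")
        case True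
        then show ?thesis by (simp add: L_def N_def)
      next
        case False
        then show ?thesis unfolding L_def N_def by (intro power_mono) auto
      qed
      then show "expectation (\<lambda>\<omega>. (T n \<omega>)\<^sup>2) \<le> C * L N * real n * sqrt (real N)"
        using C0 by (intro order.trans[OF Suc] mult_mono mult_nonneg_nonneg) (auto simp: N_def L_def)
      have "(\<Sum>i = 1..n. expectation (\<lambda>\<omega>. Q i \<omega> * Q N \<omega>)) \<le> (\<Sum>i = 1..n. c * L N / sqrt (real (N - i)))"
        unfolding L_def by (intro sum_mono corr) (auto simp: N_def)
      also have "\<dots> = c * L N * (\<Sum>d = 1..n. 1 / sqrt (real d))"
        \<comment> \<open>Reversing the order of summation turns N - i into the distance d.\<close>
        by (subst sum.atLeastAtMost_rev) (auto simp: sum_distrib_left N_def intro!: sum.cong)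
      also have "\<dots> \<le> c * L N * (2 * sqrt (real N))"
        using c L0 by (intro mult_left_mono order.trans[OF sum_inverse_sqrt_le]) (auto simp: N_def)
      finally show "(\<Sum>i = 1..n. expectation (\<lambda>\<omega>. Q i \<omega> * Q N \<omega>)) \<le> c * L N * (2 * sqrt (real N))" .
      have "expectation (\<lambda>\<omega>. Q N \<omega> * Q N \<omega>) \<le> expectation (\<lambda>\<omega>. c\<^sup>2 * L N)"
      proof (intro integral_mono Q_int N1)
        fix \<omega> assume "\<omega> \<in> space M"
        from bound[OF N1 this] have "\<bar>Q N \<omega>\<bar>\<^sup>2 \<le> (c * (1 + ln (real N)))\<^sup>2" by (intro power_mono) auto
        then show "Q N \<omega> * Q N \<omega> \<le> c\<^sup>2 * L N" by (simp add: L_def power2_eq_square algebra_simps)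
      qed simp
      also have "\<dots> = c\<^sup>2 * L N * 1" by (simp add: prob_space)
      also have "\<dots> \<le> c\<^sup>2 * L N * sqrt (real N)"
        using L0 N1 by (intro mult_left_mono) auto
      finally show "expectation (\<lambda>\<omega>. Q N \<omega> * Q N \<omega>) \<le> c\<^sup>2 * L N * sqrt (real N)" .
    qed simp
    also have "\<dots> = C * L N * real N * sqrt (real N)"
      by (simp add: C_def N_def algebra_simps)
    finally show ?case by (simp add: N_def)
  qed
  have "AE \<omega> in M. (\<lambda>k. T (k ^ 8) \<omega> / real (k ^ 8)) \<longlonglongrightarrow> 0"
  proof (rule AE_tendsto_0_if_second_moments_summable)
    show "integrable M (\<lambda>\<omega>. (T (k ^ 8) \<omega> / real (k ^ 8))\<^sup>2)" for k
      unfolding power_divide by (intro integrable_divide T_int) 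
    show "expectation (\<lambda>\<omega>. (T (k ^ 8) \<omega> / real (k ^ 8))\<^sup>2) \<le> 64 * C * (1 / real k ^ 2)" for k
    proof (cases "k = 0")
      \<comment> \<open>At k = 0 both sides vanish, since division by zero gives 0.\<close>
      case True
      then show ?thesis by simp
    next
      case False
      then have k: "real k > 0" "real k \<ge> 1" by simp_all
      \<comment> \<open>The crude bound of the squared logarithm by 64 k^2 is affordable: along k^8
        the remaining factor is k^8 k^4 / k^16 = k^(-4), so the product is still summable. An eighth
        power also makes the square root exact.\<close>
      have "L (k ^ 8) \<le> (8 * real k)\<^sup>2"
      proof -
        have "ln (real k) \<le> real k - 1" using k by (intro ln_le_minus_one)
        then have "1 + ln (real (k ^ 8)) \<le> 8 * real k" using k by (simp add: ln_realpow)
        then show ?thesis unfolding L_def using k by (intro power_mono) (auto simp: ln_realpow)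
      qed
      then have L: "L (k ^ 8) \<le> 64 * real k ^ 2" by (simp add: power_mult_distrib)
      have sq: "sqrt (real (k ^ 8)) = real k ^ 4"
        using k by (simp add: real_sqrt_unique power_mult[symmetric])
      have "expectation (\<lambda>\<omega>. (T (k ^ 8) \<omega> / real (k ^ 8))\<^sup>2) = expectation (\<lambda>\<omega>. (T (k ^ 8) \<omega>)\<^sup>2) / real k ^ 16"
        by (simp add: power_divide power_mult[symmetric])
      also have "\<dots> \<le> C * L (k ^ 8) * real (k ^ 8) * sqrt (real (k ^ 8)) / real k ^ 16"
        by (intro divide_right_mono moment) simp
      also have "\<dots> \<le> C * (64 * real k ^ 2) * real (k ^ 8) * sqrt (real (k ^ 8)) / real k ^ 16"
        using C0 L by (intro divide_right_mono mult_right_mono mult_left_mono) auto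
      also have "\<dots> = 64 * C * (1 / real k ^ 2)"
        unfolding sq using k by (simp add: field_simps power_add[symmetric])
      finally show ?thesis .
    qed
    show "summable (\<lambda>k. 64 * C * (1 / real k ^ 2))"
      using inverse_power_summable[of 2, where 'a = real] by (intro summable_mult) (simp add: inverse_eq_divide)
  qed
  then show ?thesis
  proof (rule AE_mp, intro AE_I2 impI)
    fix \<omega> assume "\<omega> \<in> space M" "(\<lambda>k. T (k ^ 8) \<omega> / real (k ^ 8)) \<longlonglongrightarrow> 0"
    then show "(\<lambda>n. (\<Sum>j = 1..n. Q j \<omega>) / real n) \<longlonglongrightarrow> 0"
      using bound c by (intro average_tendsto_0_of_subsequence) (auto simp: T_def)
  qed
qed

section \<open>Independent walks\<close>

locale independent_walks = prob_space M for M :: "'a measure" +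
  fixes \<xi> :: "nat \<Rightarrow> nat \<Rightarrow> 'a \<Rightarrow> bool" and \<alpha> :: "nat \<Rightarrow> real" and r :: nat
  assumes \<alpha>: "\<And>j. j < r \<Longrightarrow> 0 < \<alpha> j \<and> \<alpha> j < 1"
    and indep: "indep_vars (\<lambda>_. count_space UNIV) (\<lambda>(j, i). \<xi> j i) ({..<r} \<times> UNIV)"
    and prob_step: "\<And>j i. j < r \<Longrightarrow> prob {\<omega> \<in> space M. \<xi> j i \<omega>} = \<alpha> j"
begin

text \<open>A pointwise substitute for measurability with respect to the steps indexed by
  \<open>A\<close>. For finite \<open>A\<close> such a function has finitely many values, so
  measurability, integrability and independence all come from the finite step vector.\<close>

definition determined_by :: "(nat \<times> nat) set \<Rightarrow> ('a \<Rightarrow> 'b) \<Rightarrow> bool" where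
  "determined_by A F \<longleftrightarrow> (\<forall>\<omega> \<omega>'. (\<forall>(j, k) \<in> A. \<xi> j k \<omega> = \<xi> j k \<omega>') \<longrightarrow> F \<omega> = F \<omega>')"

lemma determined_byD:
  "determined_by A F \<Longrightarrow> (\<And>j k. (j, k) \<in> A \<Longrightarrow> \<xi> j k \<omega> = \<xi> j k \<omega>') \<Longrightarrow> F \<omega> = F \<omega>'"
  unfolding determined_by_def by blast

lemma determined_by_mono: "determined_by A F \<Longrightarrow> A \<subseteq> B \<Longrightarrow> determined_by B F"
  unfolding determined_by_def by blast

lemma determined_by_const: "determined_by A (\<lambda>_. c)"
  by (simp add: determined_by_def)

lemma determined_by_comp: "determined_by A F \<Longrightarrow> determined_by A (\<lambda>\<omega>. g (F \<omega>))"
  unfolding determined_by_def by (intro allI impI arg_cong[of _ _ g]) blast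

lemma determined_by_comp2:
  "determined_by A F \<Longrightarrow> determined_by A G \<Longrightarrow> determined_by A (\<lambda>\<omega>. g (F \<omega>) (G \<omega>))"
  unfolding determined_by_def by (intro allI impI arg_cong2[of _ _ _ _ g]) blast+

lemma determined_by_step: "(j, k) \<in> A \<Longrightarrow> determined_by A (\<xi> j k)"
  by (force simp: determined_by_def)

definition steps :: "(nat \<times> nat) set \<Rightarrow> 'a \<Rightarrow> nat \<times> nat \<Rightarrow> bool" where
  "steps A \<omega> = restrict (\<lambda>x. (case x of (j, i) \<Rightarrow> \<xi> j i) \<omega>) A"

text \<open>Any choice of a sample point with the given step vector serves. The factor
  \<open>f\<close> needs no regularity, because for finite \<open>A\<close> it will be used on a
  discrete space.\<close>

lemma determined_by_factor:
  assumes "determined_by A F"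
  obtains f where "F = f \<circ> steps A"
proof
  show "F = (\<lambda>g. F (SOME \<omega>. steps A \<omega> = g)) \<circ> steps A"
  proof
    fix \<omega>
    have "steps A (SOME \<omega>'. steps A \<omega>' = steps A \<omega>) = steps A \<omega>" by (rule someI) simp
    then have "\<xi> j k (SOME \<omega>'. steps A \<omega>' = steps A \<omega>) = \<xi> j k \<omega>" if "(j, k) \<in> A" for j k
      using that unfolding steps_def by (auto dest!: fun_cong[of _ _ "(j, k)"])
    from determined_byD[OF assms this] show "F \<omega> = ((\<lambda>g. F (SOME \<omega>. steps A \<omega> = g)) \<circ> steps A) \<omega>"
      by simp
  qed
qed

lemma PiM_count_space_bool:
  "finite A \<Longrightarrow> PiM A (\<lambda>_. count_space (UNIV :: bool set)) = count_space (PiE A (\<lambda>_. UNIV))"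
  by (rule count_space_PiM_finite) auto

lemma steps_measurable:
  assumes "finite A" "A \<subseteq> {..<r} \<times> UNIV"
  shows "steps A \<in> M \<rightarrow>\<^sub>M count_space (PiE A (\<lambda>_. UNIV))"
  unfolding PiM_count_space_bool[OF assms(1), symmetric] steps_def
  using indep assms by (intro measurable_restrict) (auto simp: indep_vars_def)

lemma determined_by_integrable:
  fixes F :: "'a \<Rightarrow> real"
  assumes A: "finite A" "A \<subseteq> {..<r} \<times> UNIV" and F: "determined_by A F"
  shows "integrable M F"
proof -
  obtain f where f: "F = f \<circ> steps A" using determined_by_factor[OF F] .
  have fin: "finite (f ` (PiE A (\<lambda>_. UNIV)))" using A by (intro finite_imageI finite_PiE) auto
  have "steps A \<omega> \<in> PiE A (\<lambda>_. UNIV)" for \<omega> by (simp add: steps_def)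
  then have "\<bar>F \<omega>\<bar> \<le> Max (abs ` f ` (PiE A (\<lambda>_. UNIV)))" for \<omega>
    using fin unfolding f by (intro Max_ge) auto
  moreover have "random_variable borel F"
    unfolding f using steps_measurable[OF A] by (rule measurable_comp) simp
  ultimately show ?thesis by (intro integrable_const_bound) auto
qed

lemma determined_by_expectation_mult:
  fixes F G :: "'a \<Rightarrow> real"
  assumes A: "finite A" "A \<subseteq> {..<r} \<times> UNIV" and B: "finite B" "B \<subseteq> {..<r} \<times> UNIV"
    and disj: "A \<inter> B = {}" and F: "determined_by A F" and G: "determined_by B G"
  shows "expectation (\<lambda>\<omega>. F \<omega> * G \<omega>) = expectation F * expectation G"
proof -
  obtain f where f: "F = f \<circ> steps A" using determined_by_factor[OF F] .
  obtain g where g: "G = g \<circ> steps B" using determined_by_factor[OF G] .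
  have "indep_var (PiM A (\<lambda>_. count_space UNIV)) (steps A) (PiM B (\<lambda>_. count_space UNIV)) (steps B)"
    unfolding steps_def[abs_def] by (rule indep_var_restrict[OF indep disj A(2) B(2)])
  then have "indep_var borel (f \<circ> steps A) borel (g \<circ> steps B)"
    by (rule indep_var_compose) (simp_all add: PiM_count_space_bool A B)
  then have "indep_var borel F borel G" by (simp add: f g)
  then show ?thesis
    by (rule indep_var_lebesgue_integral)
      (use assms in \<open>auto intro: determined_by_integrable\<close>)
qed

section \<open>Increments of the walks and their binomial law\<close>

definition ones :: "nat \<Rightarrow> nat \<Rightarrow> nat \<Rightarrow> 'a \<Rightarrow> nat" where
  "ones t i j \<omega> = card {k. i \<le> k \<and> k < j \<and> \<xi> t k \<omega>}"

lemma determined_by_ones: "determined_by ({t} \<times> {i..<j}) (ones t i j)"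
  unfolding determined_by_def ones_def
proof (intro allI impI)
  fix \<omega> \<omega>' assume "\<forall>(j, k)\<in>{t} \<times> {i..<j}. \<xi> j k \<omega> = \<xi> j k \<omega>'"
  then have "{k. i \<le> k \<and> k < j \<and> \<xi> t k \<omega>} = {k. i \<le> k \<and> k < j \<and> \<xi> t k \<omega>'}" by auto
  then show "card {k. i \<le> k \<and> k < j \<and> \<xi> t k \<omega>} = card {k. i \<le> k \<and> k < j \<and> \<xi> t k \<omega>'}" by simp
qed

lemma ones_concat: "i \<le> j \<Longrightarrow> j \<le> l \<Longrightarrow> ones t i l \<omega> = ones t i j \<omega> + ones t j l \<omega>"
  unfolding ones_def by (subst card_Un_disjoint[symmetric]) (auto intro!: arg_cong[of _ _ card])

lemma ones_Suc: "i \<le> j \<Longrightarrow> ones t i (Suc j) \<omega> = ones t i j \<omega> + (if \<xi> t j \<omega> then 1 else 0)"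
proof -
  have "{k. j \<le> k \<and> k < Suc j \<and> \<xi> t k \<omega>} = (if \<xi> t j \<omega> then {j} else {})"
    by (auto simp: less_Suc_eq_le dest: le_antisym)
  then have "ones t j (Suc j) \<omega> = (if \<xi> t j \<omega> then 1 else 0)" by (simp add: ones_def)
  then show "i \<le> j \<Longrightarrow> ?thesis" using ones_concat[of i j "Suc j" t \<omega>] by simp
qed

lemma ones_le: "ones t i j \<omega> \<le> j - i"
proof -
  have "ones t i j \<omega> \<le> card {i..<j}" unfolding ones_def by (intro card_mono) auto
  then show ?thesis by simp
qed

lemma walk_eq: "walk (\<xi> t) n \<omega> = (int (ones t 0 n \<omega>), int (n - ones t 0 n \<omega>))"
proof -
  have "card {k. k < n \<and> \<not> \<xi> t k \<omega>} = card ({..<n} - {k. k < n \<and> \<xi> t k \<omega>})"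
    by (rule arg_cong[of _ _ card]) auto
  also have "\<dots> = n - card {k. k < n \<and> \<xi> t k \<omega>}" by (subst card_Diff_subset) auto
  finally show ?thesis by (simp add: walk_def ones_def)
qed

lemma expectation_ones:
  fixes f :: "nat \<Rightarrow> real"
  assumes t: "t < r"
  shows "expectation (\<lambda>\<omega>. f (ones t i (i + n) \<omega>)) = (\<Sum>k\<le>n. Bernstein n k (\<alpha> t) * f k)"
proof (induction n arbitrary: f)
  case 0
  have "ones t i i \<omega> = 0" for \<omega> using ones_le[of t i i \<omega>] by simp
  then show ?case by (simp add: prob_space Bernstein_def)
next
  case (Suc n)
  \<comment> \<open>The last step is split off; it is independent of the steps in \<open>D\<close>.
    The induction hypothesis is applied both to \<open>f\<close> and to its shift.\<close>
  define S where "S = {(t, i + n)}"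
  define D where "D = {t} \<times> {i..<i + n}"
  have S: "finite S" "S \<subseteq> {..<r} \<times> UNIV" and D: "finite D" "D \<subseteq> {..<r} \<times> UNIV" and SD: "S \<inter> D = {}"
    using t by (auto simp: S_def D_def)
  have dS: "determined_by S (\<lambda>\<omega>. of_bool (\<xi> t (i + n) \<omega>) :: real)"
    by (rule determined_by_comp[OF determined_by_step]) (simp add: S_def)
  have dS': "determined_by S (\<lambda>\<omega>. 1 - of_bool (\<xi> t (i + n) \<omega>) :: real)"
    by (rule determined_by_comp[OF dS])
  have dD: "determined_by D (\<lambda>\<omega>. g (ones t i (i + n) \<omega>))" for g :: "nat \<Rightarrow> real"
    unfolding D_def by (rule determined_by_comp[OF determined_by_ones])
  have d: "determined_by (S \<union> D) (\<lambda>\<omega>. F \<omega> * g (ones t i (i + n) \<omega>))" if "determined_by S F"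
    for F :: "'a \<Rightarrow> real" and g
    by (rule determined_by_comp2[of _ _ _ "(*)"]) (use that dD in \<open>auto intro: determined_by_mono\<close>)
  have int: "integrable M (\<lambda>\<omega>. F \<omega> * g (ones t i (i + n) \<omega>))" if "determined_by S F" for F :: "'a \<Rightarrow> real" and g
    by (rule determined_by_integrable[OF _ _ d[OF that]]) (use S D in auto)
  have "\<xi> t (i + n) \<in> M \<rightarrow>\<^sub>M count_space UNIV" using indep t by (auto simp: indep_vars_def)
  then have meas: "{\<omega> \<in> space M. \<xi> t (i + n) \<omega>} \<in> events" unfolding pred_def .
  have "expectation (\<lambda>\<omega>. of_bool (\<xi> t (i + n) \<omega>)) = expectation (indicator {\<omega> \<in> space M. \<xi> t (i + n) \<omega>})"
    by (intro Bochner_Integration.integral_cong) (auto simp: indicator_def)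
  also have "\<dots> = \<alpha> t" using meas prob_step[OF t] by simp
  finally have E: "expectation (\<lambda>\<omega>. of_bool (\<xi> t (i + n) \<omega>)) = \<alpha> t" .
  have E': "expectation (\<lambda>\<omega>. 1 - of_bool (\<xi> t (i + n) \<omega>)) = 1 - \<alpha> t"
    using E determined_by_integrable[OF S dS] by (simp add: prob_space)
  have "f (ones t i (i + Suc n) \<omega>) = of_bool (\<xi> t (i + n) \<omega>) * f (Suc (ones t i (i + n) \<omega>))
      + (1 - of_bool (\<xi> t (i + n) \<omega>)) * f (ones t i (i + n) \<omega>)" for \<omega>
    by (simp add: ones_Suc)
  then have "expectation (\<lambda>\<omega>. f (ones t i (i + Suc n) \<omega>)) =
      expectation (\<lambda>\<omega>. of_bool (\<xi> t (i + n) \<omega>) * f (Suc (ones t i (i + n) \<omega>)))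
      + expectation (\<lambda>\<omega>. (1 - of_bool (\<xi> t (i + n) \<omega>)) * f (ones t i (i + n) \<omega>))"
    using int[OF dS, of "\<lambda>x. f (Suc x)"] int[OF dS', of f] by simp
  also have "expectation (\<lambda>\<omega>. of_bool (\<xi> t (i + n) \<omega>) * f (Suc (ones t i (i + n) \<omega>)))
      = \<alpha> t * (\<Sum>k\<le>n. Bernstein n k (\<alpha> t) * f (Suc k))"
    using determined_by_expectation_mult[OF S D SD dS dD[of "\<lambda>x. f (Suc x)"]] E Suc.IH[of "\<lambda>x. f (Suc x)"] by simp
  also have "expectation (\<lambda>\<omega>. (1 - of_bool (\<xi> t (i + n) \<omega>)) * f (ones t i (i + n) \<omega>))
      = (1 - \<alpha> t) * (\<Sum>k\<le>n. Bernstein n k (\<alpha> t) * f k)"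
    using determined_by_expectation_mult[OF S D SD dS' dD[of f]] E' Suc.IH[of f] by simp
  finally show ?case by (simp only: sum_Bernstein_Suc)
qed

lemma expectation_ones_difference_bound:
  fixes f :: "nat \<Rightarrow> real"
  assumes t: "t < r" and K: "\<And>k. \<bar>f k\<bar> \<le> K"
  shows "\<bar>expectation (\<lambda>\<omega>. f (Suc (x + ones t i (i + n) \<omega>)) - f (x + ones t i (i + n) \<omega>))\<bar>
    \<le> K / sqrt (real (Suc n) * \<alpha> t * (1 - \<alpha> t))"
  using sum_Bernstein_difference_bound[of "\<alpha> t" "\<lambda>k. f (x + k)" K n] \<alpha>[OF t] K
  by (subst expectation_ones[OF t, of "\<lambda>y. f (Suc (x + y)) - f (x + y)"]) auto

lemma expectation_mult_difference_bound:
  fixes f :: "nat \<Rightarrow> real" and G :: "'a \<Rightarrow> real"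
  assumes t: "t < r" and ij: "i \<le> j" and K: "\<And>k. \<bar>f k\<bar> \<le> K" and G: "\<And>\<omega>. \<bar>G \<omega>\<bar> \<le> B"
    and A: "finite A" "A \<subseteq> {..<r} \<times> UNIV" "{t} \<times> {..<i} \<subseteq> A" "A \<inter> {t} \<times> {i..<j} = {}"
    and dG: "determined_by A G"
  shows "\<bar>expectation (\<lambda>\<omega>. G \<omega> * (f (Suc (ones t 0 j \<omega>)) - f (ones t 0 j \<omega>)))\<bar>
    \<le> B * (K / sqrt (real (Suc (j - i)) * \<alpha> t * (1 - \<alpha> t)))"
proof -
  define n where "n = j - i"
  have j: "j = i + n" using ij by (simp add: n_def)
  define \<kappa> where "\<kappa> = K / sqrt (real (Suc n) * \<alpha> t * (1 - \<alpha> t))"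
  have K0: "K \<ge> 0" using K[of 0] by linarith
  have \<kappa>0: "\<kappa> \<ge> 0" using K0 \<alpha>[OF t] by (simp add: \<kappa>_def)
  define h where "h = (\<lambda>x. f (Suc x) - f x)"
  define D where "D = {t} \<times> {i..<i + n}"
  have D: "finite D" "D \<subseteq> {..<r} \<times> UNIV" "A \<inter> D = {}" using t A by (auto simp: D_def j)
  \<comment> \<open>Conditioning on the position at time i is carried out by a finite partition into
    indicators, which sum to 1.\<close>
  define I where "I = (\<lambda>x \<omega>. of_bool (ones t 0 i \<omega> = x) :: real)"
  have dI: "determined_by A (I x)" for x
    unfolding I_def
    by (rule determined_by_comp, rule determined_by_mono[OF determined_by_ones]) (use A in auto)
  have dGI: "determined_by A (\<lambda>\<omega>. G \<omega> * I x \<omega>)" for x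
    by (rule determined_by_comp2[OF dG dI])
  have dh: "determined_by D (\<lambda>\<omega>. h (x + ones t i (i + n) \<omega>))" for x
    unfolding D_def by (rule determined_by_comp[OF determined_by_ones])
  have split: "G \<omega> * h (ones t 0 j \<omega>) = (\<Sum>x\<le>i. G \<omega> * I x \<omega> * h (x + ones t i (i + n) \<omega>))" for \<omega>
  proof -
    have "(\<Sum>x\<le>i. G \<omega> * I x \<omega> * h (x + ones t i (i + n) \<omega>))
      = (\<Sum>x\<le>i. if x = ones t 0 i \<omega> then G \<omega> * h (x + ones t i (i + n) \<omega>) else 0)"
      by (intro sum.cong refl) (auto simp: I_def)
    also have "\<dots> = G \<omega> * h (ones t 0 j \<omega>)"
      using ones_le[of t 0 i \<omega>] ones_concat[of 0 i j t \<omega>] by (simp add: j)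
    finally show ?thesis ..
  qed
  have int: "integrable M (\<lambda>\<omega>. G \<omega> * I x \<omega> * h (x + ones t i (i + n) \<omega>))" for x
  proof (rule determined_by_integrable)
    show "determined_by (A \<union> D) (\<lambda>\<omega>. G \<omega> * I x \<omega> * h (x + ones t i (i + n) \<omega>))"
      by (rule determined_by_comp2[of _ _ _ "(*)"]) (use dGI dh in \<open>auto intro: determined_by_mono\<close>)
  qed (use A D in auto)
  have intI: "integrable M (I x)" for x by (rule determined_by_integrable[OF A(1,2) dI])
  have "\<bar>expectation (\<lambda>\<omega>. G \<omega> * h (ones t 0 j \<omega>))\<bar>
     = \<bar>\<Sum>x\<le>i. expectation (\<lambda>\<omega>. G \<omega> * I x \<omega> * h (x + ones t i (i + n) \<omega>))\<bar>"
    unfolding split by (subst Bochner_Integration.integral_sum[OF int]) simp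
  also have "\<dots> = \<bar>\<Sum>x\<le>i. expectation (\<lambda>\<omega>. G \<omega> * I x \<omega>) * expectation (\<lambda>\<omega>. h (x + ones t i (i + n) \<omega>))\<bar>"
    by (subst determined_by_expectation_mult[OF A(1,2) D dGI dh]) simp
  also have "\<dots> \<le> (\<Sum>x\<le>i. B * expectation (I x) * \<kappa>)"
  proof (rule order.trans[OF sum_abs], rule sum_mono)
    fix x
    have "\<bar>expectation (\<lambda>\<omega>. h (x + ones t i (i + n) \<omega>))\<bar> \<le> \<kappa>"
      unfolding h_def \<kappa>_def by (rule expectation_ones_difference_bound[OF t K])
    moreover have "\<bar>expectation (\<lambda>\<omega>. G \<omega> * I x \<omega>)\<bar> \<le> expectation (\<lambda>\<omega>. B * I x \<omega>)"
    proof (rule order.trans[OF integral_abs_bound], rule integral_mono)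
      show "integrable M (\<lambda>\<omega>. \<bar>G \<omega> * I x \<omega>\<bar>)"
        using determined_by_integrable[OF A(1,2) dGI] by simp
      show "\<bar>G \<omega> * I x \<omega>\<bar> \<le> B * I x \<omega>" for \<omega> using G[of \<omega>] by (simp add: I_def)
    qed (use intI in simp)
    ultimately show "\<bar>expectation (\<lambda>\<omega>. G \<omega> * I x \<omega>) * expectation (\<lambda>\<omega>. h (x + ones t i (i + n) \<omega>))\<bar>
        \<le> B * expectation (I x) * \<kappa>"
      unfolding abs_mult by (intro mult_mono) auto
  qed
  also have "\<dots> = B * expectation (\<lambda>\<omega>. \<Sum>x\<le>i. I x \<omega>) * \<kappa>"
    using intI by (subst Bochner_Integration.integral_sum) (auto simp: sum_distrib_left sum_distrib_right)
  also have "(\<lambda>\<omega>. \<Sum>x\<le>i. I x \<omega>) = (\<lambda>\<omega>. 1)"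
    using ones_le[of t 0 i] by (auto simp: I_def of_bool_def)
  finally show ?thesis by (simp add: prob_space h_def \<kappa>_def n_def)
qed

text \<open>The common source of both frequency statements. A factor \<open>G j\<close> determined
  by the other walks is harmless, because only the steps of walk t between the two times are
  averaged out.\<close>

lemma AE_average_walk_difference:
  fixes F :: "nat \<Rightarrow> nat \<Rightarrow> real" and G :: "nat \<Rightarrow> 'a \<Rightarrow> real"
  assumes t: "t < r" and c: "c \<ge> 0"
    and F: "\<And>j k. j \<ge> 1 \<Longrightarrow> \<bar>F j k\<bar> \<le> c * (1 + ln (real j))"
    and G: "\<And>j \<omega>. \<bar>G j \<omega>\<bar> \<le> 1" and dG: "\<And>j. determined_by (({..<r} - {t}) \<times> {..<j}) (G j)"
  shows "AE \<omega> in M. (\<lambda>n. (\<Sum>j = 1..n. G j \<omega> * (F j (Suc (ones t 0 j \<omega>)) - F j (ones t 0 j \<omega>))) / real n) \<longlonglongrightarrow> 0"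
proof -
  define Q where "Q = (\<lambda>j \<omega>. G j \<omega> * (F j (Suc (ones t 0 j \<omega>)) - F j (ones t 0 j \<omega>)))"
  define b where "b = \<alpha> t * (1 - \<alpha> t)"
  have b: "b > 0" using \<alpha>[OF t] by (simp add: b_def)
  \<comment> \<open>One constant for both hypotheses of the strong law: the first summand bounds the
    variables, the second their correlations.\<close>
  define C where "C = 2 * c + 2 * c * c / sqrt b"
  have C: "0 \<le> C" "2 * c \<le> C" "2 * c * c / sqrt b \<le> C" using c b by (simp_all add: C_def)
  define L where "L = (\<lambda>j::nat. 1 + ln (real j))"
  have L0: "L j \<ge> 0" if "j \<ge> 1" for j using that by (simp add: L_def)
  have dQ: "determined_by ({..<r} \<times> {..<j}) (Q j)" for j
    unfolding Q_def
  proof (rule determined_by_comp2[of _ _ _ "(*)"])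
    show "determined_by ({..<r} \<times> {..<j}) (G j)" using dG by (rule determined_by_mono) auto
    have "determined_by ({..<r} \<times> {..<j}) (ones t 0 j)"
      using determined_by_ones by (rule determined_by_mono) (use t in auto)
    then show "determined_by ({..<r} \<times> {..<j}) (\<lambda>\<omega>. F j (Suc (ones t 0 j \<omega>)) - F j (ones t 0 j \<omega>))"
      by (rule determined_by_comp)
  qed
  have bound: "\<bar>Q j \<omega>\<bar> \<le> 2 * c * L j" if "j \<ge> 1" for j \<omega>
  proof -
    have "\<bar>F j (Suc (ones t 0 j \<omega>)) - F j (ones t 0 j \<omega>)\<bar> \<le> 2 * c * L j"
      using F[OF that, of "Suc (ones t 0 j \<omega>)"] F[OF that, of "ones t 0 j \<omega>"] by (simp add: L_def)
    then have "\<bar>Q j \<omega>\<bar> \<le> 1 * (2 * c * L j)"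
      unfolding Q_def abs_mult using G[of j \<omega>] by (intro mult_mono) auto
    then show ?thesis by simp
  qed
  have "AE \<omega> in M. (\<lambda>n. (\<Sum>j = 1..n. Q j \<omega>) / real n) \<longlonglongrightarrow> 0"
  proof (rule AE_average_tendsto_0_of_decorrelation[OF _ C(1)])
    show "random_variable borel (Q j)" for j
      using determined_by_integrable[OF _ _ dQ[of j]] by auto
    show "\<bar>Q j \<omega>\<bar> \<le> C * (1 + ln (real j))" if "j \<ge> 1" for j \<omega>
      using order.trans[OF bound[OF that, of \<omega>] mult_right_mono[OF C(2) L0[OF that]]] by (simp add: L_def)
    show "expectation (\<lambda>\<omega>. Q i \<omega> * Q j \<omega>) \<le> C * (1 + ln (real j))\<^sup>2 / sqrt (real (j - i))"
      if ij: "1 \<le> i" "i < j" for i j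
    proof -
      \<comment> \<open>Everything up to time j except the fresh steps of walk t; this determines
        both \<open>Q i\<close> and \<open>G j\<close>.\<close>
      define A where "A = {..<r} \<times> {..<j} - {t} \<times> {i..<j}"
      have j1: "j \<ge> 1" using ij by simp
      have Lij: "L i \<le> L j" using ij by (simp add: L_def)
      have "\<bar>expectation (\<lambda>\<omega>. (Q i \<omega> * G j \<omega>) * (F j (Suc (ones t 0 j \<omega>)) - F j (ones t 0 j \<omega>)))\<bar>
        \<le> (2 * c * L j) * (c * L j / sqrt (real (Suc (j - i)) * \<alpha> t * (1 - \<alpha> t)))"
      proof (rule expectation_mult_difference_bound[OF t])
        show "\<bar>F j k\<bar> \<le> c * L j" for k using F[OF j1] by (simp add: L_def)
        show "\<bar>Q i \<omega> * G j \<omega>\<bar> \<le> 2 * c * L j" for \<omega>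
        proof -
          have "\<bar>Q i \<omega> * G j \<omega>\<bar> \<le> (2 * c * L i) * 1"
            unfolding abs_mult using bound[OF ij(1), of \<omega>] G[of j \<omega>] c L0[OF ij(1)] by (intro mult_mono) auto
          also have "\<dots> \<le> 2 * c * L j" using c Lij by (simp add: mult_left_mono)
          finally show ?thesis .
        qed
        show "finite A" "A \<subseteq> {..<r} \<times> UNIV" "{t} \<times> {..<i} \<subseteq> A" "A \<inter> {t} \<times> {i..<j} = {}"
          using t ij by (auto simp: A_def)
        show "determined_by A (\<lambda>\<omega>. Q i \<omega> * G j \<omega>)"
        proof (rule determined_by_comp2[of _ _ _ "(*)"])
          show "determined_by A (Q i)" using dQ by (rule determined_by_mono) (use ij in \<open>auto simp: A_def\<close>)
          show "determined_by A (G j)" using dG by (rule determined_by_mono) (auto simp: A_def)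
        qed
      qed (use ij in simp)
      then have "expectation (\<lambda>\<omega>. Q i \<omega> * Q j \<omega>)
        \<le> (2 * c * L j) * (c * L j / sqrt (real (Suc (j - i)) * \<alpha> t * (1 - \<alpha> t)))"
        by (simp add: Q_def mult.assoc)
      also have "\<dots> = 2 * c * c / sqrt b * (L j)\<^sup>2 / sqrt (real (Suc (j - i)))"
        by (simp add: b_def real_sqrt_mult power2_eq_square mult_ac)
      also have "\<dots> \<le> C * (L j)\<^sup>2 / sqrt (real (j - i))"
      proof (rule frac_le)
        show "0 \<le> C * (L j)\<^sup>2" using C(1) by (intro mult_nonneg_nonneg) simp_all
        show "2 * c * c / sqrt b * (L j)\<^sup>2 \<le> C * (L j)\<^sup>2" using C(3) by (intro mult_right_mono) simp_all
        show "0 < sqrt (real (j - i))" "sqrt (real (j - i)) \<le> sqrt (real (Suc (j - i)))" using ij(2) by simp_all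
      qed
      finally show ?thesis by (simp add: L_def)
    qed
  qed
  then show ?thesis by (simp add: Q_def)
qed

end

section \<open>Local densities and the sieve\<close>

text \<open>The height of the walk at time i is i - x; the integer difference makes the condition periodic
  in i and x without the constraint x \<open>\<le>\<close> i.\<close>
definition locally_visible :: "nat \<Rightarrow> nat \<Rightarrow> nat \<Rightarrow> nat \<Rightarrow> nat \<Rightarrow> bool" where
  "locally_visible b1 b2 p i x \<longleftrightarrow> \<not> (int p ^ b1 dvd int x \<and> int p ^ b2 dvd int i - int x)"

text \<open>The proportion of residues x modulo p^(max b1 b2) that are locally visible at time
  i.\<close>

definition local_mean :: "nat \<Rightarrow> nat \<Rightarrow> nat \<Rightarrow> nat \<Rightarrow> real" where
  "local_mean b1 b2 p i = 1 - of_bool (p ^ min b1 b2 dvd i) / real p ^ max b1 b2"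

text \<open>The Euler factor: the average over i of the r-th power of \<open>local_mean\<close>. The
  power reflects the independence of the walks at a given time, while the average reflects that all
  of them share that time.\<close>

definition local_density :: "nat \<Rightarrow> nat \<Rightarrow> nat \<Rightarrow> nat \<Rightarrow> real" where
  "local_density b1 b2 r p =
     1 - 1 / real p ^ min b1 b2 + (1 / real p ^ min b1 b2) * (1 - 1 / real p ^ max b1 b2) ^ r"

lemma locally_visible_mod:
  "locally_visible b1 b2 p i (x mod p ^ max b1 b2) \<longleftrightarrow> locally_visible b1 b2 p i x"
proof -
  have dvd: "int p ^ b1 dvd int (p ^ max b1 b2)" "int p ^ b2 dvd int (p ^ max b1 b2)"
    by (simp_all add: le_imp_power_dvd)
  define q where "q = int (x div p ^ max b1 b2)"
  have x: "int x = int (p ^ max b1 b2) * q + int (x mod p ^ max b1 b2)"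
    unfolding q_def of_nat_mult[symmetric] of_nat_add[symmetric] by simp
  have "int p ^ b1 dvd int (x mod p ^ max b1 b2) \<longleftrightarrow> int p ^ b1 dvd int x"
    unfolding x using dvd(1) by (simp add: dvd_add_right_iff)
  moreover have "int p ^ b2 dvd int i - int (x mod p ^ max b1 b2) \<longleftrightarrow> int p ^ b2 dvd int i - int x"
  proof -
    have "int i - int (x mod p ^ max b1 b2) = int (p ^ max b1 b2) * q + (int i - int x)"
      using x by linarith
    then show ?thesis using dvd(2) by (simp only: dvd_add_right_iff[OF dvd_mult2])
  qed
  ultimately show ?thesis unfolding locally_visible_def by simp
qed

text \<open>The two divisibilities are compatible iff p^(min b1 b2) divides i, and then they leave
  exactly one residue: that of i if b1 \<le> b2, and 0 otherwise.\<close>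

lemma sum_locally_visible:
  assumes p: "p > 0"
  shows "(\<Sum>x<p ^ max b1 b2. of_bool (locally_visible b1 b2 p i x)) = real (p ^ max b1 b2) * local_mean b1 b2 p i"
proof -
  define A where "A = {x. x < p ^ max b1 b2 \<and> int p ^ b1 dvd int x \<and> int p ^ b2 dvd int i - int x}"
  have dvd_iff: "int p ^ b dvd int y \<longleftrightarrow> p ^ b dvd y" for b y
    by (metis of_nat_dvd_iff of_nat_power)
  have "card A = of_bool (p ^ min b1 b2 dvd i)"
  proof (cases "b1 \<le> b2")
    case True
    have "x \<in> A \<longleftrightarrow> x = i mod p ^ b2 \<and> p ^ b1 dvd i" for x
    proof -
      have "x < p ^ b2 \<and> int p ^ b2 dvd int i - int x \<longleftrightarrow> x = i mod p ^ b2"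
      proof -
        have "int p ^ b2 dvd int i - int x \<longleftrightarrow> int i mod int p ^ b2 = int x mod int p ^ b2"
          by (simp add: mod_eq_dvd_iff)
        also have "\<dots> \<longleftrightarrow> i mod p ^ b2 = x mod p ^ b2"
          by (metis of_nat_eq_iff of_nat_mod of_nat_power)
        finally show ?thesis using p by auto
      qed
      moreover have "int p ^ b1 dvd int x \<longleftrightarrow> p ^ b1 dvd i" if "x = i mod p ^ b2"
        unfolding dvd_iff that using True by (simp add: dvd_mod_iff le_imp_power_dvd)
      ultimately show ?thesis using True unfolding A_def by (auto simp: max_def)
    qed
    then have "A = (if p ^ b1 dvd i then {i mod p ^ b2} else {})" by auto
    then show ?thesis using True by (auto simp: min_def)
  next
    case False
    have "x \<in> A \<longleftrightarrow> x = 0 \<and> p ^ b2 dvd i" for x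
    proof -
      have "x < p ^ b1 \<and> int p ^ b1 dvd int x \<longleftrightarrow> x = 0"
        unfolding dvd_iff using p by (auto dest: dvd_imp_le)
      then show ?thesis using False unfolding A_def by (auto simp: max_def dvd_iff)
    qed
    then have "A = (if p ^ b2 dvd i then {0} else {})" by auto
    then show ?thesis using False by (auto simp: min_def)
  qed
  moreover have "(\<Sum>x<p ^ max b1 b2. of_bool (locally_visible b1 b2 p i x)) = real (p ^ max b1 b2) - real (card A)"
  proof -
    have "(\<Sum>x<p ^ max b1 b2. of_bool (locally_visible b1 b2 p i x) :: real) =
       (\<Sum>x<p ^ max b1 b2. 1 - of_bool (x \<in> A))"
      by (intro sum.cong refl) (auto simp: A_def locally_visible_def)
    also have "\<dots> = real (p ^ max b1 b2) - real (card ({..<p ^ max b1 b2} \<inter> A))"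
      by (simp add: sum_subtractf of_bool_def sum.If_cases Int_def)
    also have "{..<p ^ max b1 b2} \<inter> A = A" by (auto simp: A_def)
    finally show ?thesis .
  qed
  ultimately show ?thesis using p by (simp add: local_mean_def algebra_simps)
qed

lemma local_mean_mod: "local_mean b1 b2 p (i mod p ^ max b1 b2) = local_mean b1 b2 p i"
  unfolding local_mean_def by (simp add: dvd_mod_iff le_imp_power_dvd)

lemma card_multiples_lessThan:
  fixes d e :: nat
  assumes "d > 0"
  shows "card {i. i < d * e \<and> d dvd i} = e"
proof -
  have "{i. i < d * e \<and> d dvd i} = (\<lambda>k. d * k) ` {..<e}" using assms by (auto elim!: dvdE)
  then show ?thesis using assms by (simp add: card_image inj_on_def)
qed

lemma sum_local_mean_power:
  assumes p: "p > 0"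
  shows "(\<Sum>i<p ^ max b1 b2. local_mean b1 b2 p i ^ r) = real (p ^ max b1 b2) * local_density b1 b2 r p"
proof -
  define m B where "m = min b1 b2" and "B = max b1 b2"
  have mB: "m \<le> B" by (simp add: m_def B_def)
  define u where "u = (1 - 1 / real p ^ B) ^ r"
  have "(\<Sum>i<p ^ B. local_mean b1 b2 p i ^ r) = (\<Sum>i<p ^ B. 1 + of_bool (p ^ m dvd i) * (u - 1))"
    by (intro sum.cong refl) (auto simp: local_mean_def m_def B_def u_def)
  also have "\<dots> = real (p ^ B) + (\<Sum>i<p ^ B. of_bool (p ^ m dvd i)) * (u - 1)"
    by (simp add: sum.distrib sum_distrib_right)
  also have "(\<Sum>i<p ^ B. of_bool (p ^ m dvd i) :: real) = real (card {i. i < p ^ m * p ^ (B - m) \<and> p ^ m dvd i})"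
    using mB by (simp add: of_bool_def sum.If_cases Int_def power_add[symmetric])
  also have "\<dots> = real (p ^ (B - m))"
    by (subst card_multiples_lessThan) (use p in auto)
  also have "real (p ^ (B - m)) = real (p ^ B) * (1 / real p ^ m)"
    unfolding of_nat_power using p mB by (simp add: power_diff)
  finally show ?thesis
    by (simp add: local_density_def u_def m_def[symmetric] B_def[symmetric] algebra_simps)
qed

section \<open>Sieving by the primes up to a cutoff\<close>

definition primes_upto :: "nat \<Rightarrow> nat set" where
  "primes_upto N = {p. prime p \<and> p \<le> N}"

lemma finite_primes_upto [simp]: "finite (primes_upto N)"
  unfolding primes_upto_def by (rule finite_subset[of _ "{..N}"]) auto

definition modulus :: "nat \<Rightarrow> nat \<Rightarrow> nat \<Rightarrow> nat" where
  "modulus b1 b2 N = (\<Prod>p\<in>primes_upto N. p ^ max b1 b2)"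

definition sieved :: "nat \<Rightarrow> nat \<Rightarrow> nat \<Rightarrow> nat \<Rightarrow> nat \<Rightarrow> real" where
  "sieved b1 b2 N i x = (\<Prod>p\<in>primes_upto N. of_bool (locally_visible b1 b2 p i x))"

definition sieved_mean :: "nat \<Rightarrow> nat \<Rightarrow> nat \<Rightarrow> nat \<Rightarrow> real" where
  "sieved_mean b1 b2 N i = (\<Prod>p\<in>primes_upto N. local_mean b1 b2 p i)"

lemma modulus_pos: "modulus b1 b2 N > 0"
  unfolding modulus_def primes_upto_def by (intro prod_pos) (auto dest: prime_gt_0_nat)

lemma sieved_eq_of_bool:
  "sieved b1 b2 N i x = of_bool (\<forall>p\<in>primes_upto N. locally_visible b1 b2 p i x)"
  unfolding sieved_def by (auto simp: prod_zero_iff)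

lemma sum_sieved: "(\<Sum>x<modulus b1 b2 N. sieved b1 b2 N i x) = real (modulus b1 b2 N) * sieved_mean b1 b2 N i"
proof -
  have "(\<Sum>x<modulus b1 b2 N. sieved b1 b2 N i x)
      = (\<Prod>p\<in>primes_upto N. \<Sum>x<p ^ max b1 b2. of_bool (locally_visible b1 b2 p i x))"
    unfolding modulus_def sieved_def
    by (rule sum_prod_coprime_periods)
      (auto simp: locally_visible_mod primes_upto_def dest: prime_gt_0_nat
        intro: primes_coprime)
  also have "\<dots> = (\<Prod>p\<in>primes_upto N. real (p ^ max b1 b2) * local_mean b1 b2 p i)"
    by (intro prod.cong refl sum_locally_visible) (auto simp: primes_upto_def dest: prime_gt_0_nat)
  finally show ?thesis by (simp add: prod.distrib modulus_def sieved_mean_def)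
qed

lemma sum_sieved_mean_power:
  "(\<Sum>i<modulus b1 b2 N. sieved_mean b1 b2 N i ^ r)
     = real (modulus b1 b2 N) * (\<Prod>p\<in>primes_upto N. local_density b1 b2 r p)"
proof -
  have power: "(\<Prod>p\<in>primes_upto N. local_mean b1 b2 p i) ^ r = (\<Prod>p\<in>primes_upto N. local_mean b1 b2 p i ^ r)" for i
    by (rule prod_power_distrib)
  have "(\<Sum>i<modulus b1 b2 N. sieved_mean b1 b2 N i ^ r)
      = (\<Prod>p\<in>primes_upto N. \<Sum>i<p ^ max b1 b2. local_mean b1 b2 p i ^ r)"
    unfolding modulus_def sieved_mean_def power
    by (rule sum_prod_coprime_periods)
      (auto simp: local_mean_mod primes_upto_def dest: prime_gt_0_nat
        intro: primes_coprime)
  also have "\<dots> = (\<Prod>p\<in>primes_upto N. real (p ^ max b1 b2) * local_density b1 b2 r p)"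
    by (intro prod.cong refl sum_local_mean_power) (auto simp: primes_upto_def dest: prime_gt_0_nat)
  finally show ?thesis by (simp add: prod.distrib modulus_def)
qed

lemma periodic_mod_add:
  fixes f :: "nat \<Rightarrow> 'b"
  assumes "\<And>x. f (x mod d) = f x" and "d dvd m"
  shows "f (x + m) = f x"
  using assms by (metis dvd_imp_mod_0 mod_add_right_eq add_0_right)

lemma sieved_add_modulus: "sieved b1 b2 N i (x + modulus b1 b2 N) = sieved b1 b2 N i x"
  unfolding sieved_def
proof (intro prod.cong refl)
  fix p assume p: "p \<in> primes_upto N"
  show "of_bool (locally_visible b1 b2 p i (x + modulus b1 b2 N)) = of_bool (locally_visible b1 b2 p i x)"
    by (subst periodic_mod_add[of "locally_visible b1 b2 p i" "p ^ max b1 b2"])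
      (use p in \<open>auto simp: locally_visible_mod modulus_def intro!: dvd_prodI\<close>)
qed

lemma sieved_mean_add_modulus: "sieved_mean b1 b2 N (i + modulus b1 b2 N) = sieved_mean b1 b2 N i"
  unfolding sieved_mean_def
proof (intro prod.cong refl)
  fix p assume p: "p \<in> primes_upto N"
  show "local_mean b1 b2 p (i + modulus b1 b2 N) = local_mean b1 b2 p i"
    by (rule periodic_mod_add[of "local_mean b1 b2 p" "p ^ max b1 b2"])
      (use p in \<open>auto simp: local_mean_mod modulus_def intro!: dvd_prodI\<close>)
qed

lemma sieved_mean_bounds: "0 \<le> sieved_mean b1 b2 N i" "sieved_mean b1 b2 N i \<le> 1"
proof -
  have "0 \<le> local_mean b1 b2 p i \<and> local_mean b1 b2 p i \<le> 1" if "p \<in> primes_upto N" for p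
    using that by (auto simp: local_mean_def primes_upto_def of_bool_def dest!: prime_ge_1_nat)
  then show "0 \<le> sieved_mean b1 b2 N i" "sieved_mean b1 b2 N i \<le> 1"
    unfolding sieved_mean_def by (auto intro: prod_nonneg prod_le_1)
qed

lemma average_sieved_mean_power:
  "(\<lambda>n. (\<Sum>i = 1..n. sieved_mean b1 b2 N i ^ r) / real n)
     \<longlonglongrightarrow> (\<Prod>p\<in>primes_upto N. local_density b1 b2 r p)"
proof -
  have "(\<lambda>n. (\<Sum>i = 1..n. sieved_mean b1 b2 N i ^ r) / real n)
     \<longlonglongrightarrow> (\<Sum>i<modulus b1 b2 N. sieved_mean b1 b2 N i ^ r) / real (modulus b1 b2 N)"
    by (rule periodic_average_tendsto)
      (auto simp: modulus_pos sieved_mean_add_modulus sieved_mean_bounds)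
  then show ?thesis using modulus_pos[of b1 b2 N] by (simp add: sum_sieved_mean_power)
qed

lemma sieved_partial_sum_bound:
  "\<bar>\<Sum>l<k. sieved b1 b2 N i l - sieved_mean b1 b2 N i\<bar> \<le> real (modulus b1 b2 N)"
proof -
  have "\<bar>\<Sum>l<k. sieved b1 b2 N i l - (\<Sum>l<modulus b1 b2 N. sieved b1 b2 N i l) / real (modulus b1 b2 N)\<bar>
      \<le> (\<Sum>l<modulus b1 b2 N. sieved b1 b2 N i l)"
    by (rule periodic_partial_sum_bound, rule modulus_pos, rule sieved_add_modulus)
      (simp add: sieved_eq_of_bool)
  also have "\<dots> \<le> real (modulus b1 b2 N) * 1"
    unfolding sum_sieved by (intro mult_left_mono sieved_mean_bounds) simp
  finally show ?thesis using modulus_pos[of b1 b2 N] by (simp add: sum_sieved)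
qed

text \<open>Exactly one l in each period is counted, so the bound is 1 independently of d. This
  uniformity is what admits moduli as large as the time itself.\<close>

lemma multiple_indicator_partial_sum_bound:
  assumes d: "d > (0::nat)"
  shows "\<bar>\<Sum>l<k. of_bool (d dvd l + a) - 1 / real d\<bar> \<le> 1"
proof -
  have "l < d \<and> d dvd l + a \<longleftrightarrow> l = nat ((- int a) mod int d)" for l
  proof -
    have "d dvd l + a \<longleftrightarrow> int d dvd int l - (- int a)"
      by (metis diff_minus_eq_add of_nat_add of_nat_dvd_iff)
    also have "\<dots> \<longleftrightarrow> int l mod int d = (- int a) mod int d" by (simp only: mod_eq_dvd_iff)
    finally have *: "d dvd l + a \<longleftrightarrow> int l mod int d = (- int a) mod int d" .
    have "0 \<le> (- int a) mod int d" "(- int a) mod int d < int d" using d by simp_all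
    then show ?thesis unfolding * by (auto simp: nat_less_iff)
  qed
  then have "{..<d} \<inter> {l. d dvd l + a} = {nat ((- int a) mod int d)}" by auto
  then have S: "(\<Sum>l<d. of_bool (d dvd l + a)) = (1 :: real)"
    by (simp add: of_bool_def sum.If_cases)
  have "d dvd l + d + a \<longleftrightarrow> d dvd l + a" for l
    using dvd_add_triv_right_iff[of d "l + a"] by (simp add: ac_simps)
  then show ?thesis
    using periodic_partial_sum_bound[of d "\<lambda>l. of_bool (d dvd l + a)" k] d unfolding S by simp
qed

text \<open>Factors before t are already replaced by the mean \<open>g\<close>, those after t are
  still random. Hence the weight of \<open>v t - g\<close> contains no trace of the t-th
  factor.\<close>

lemma prod_minus_power_telescope:
  fixes v :: "nat \<Rightarrow> 'b :: comm_ring_1"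
  shows "(\<Prod>t<r. v t) - g ^ r = (\<Sum>t<r. g ^ t * (\<Prod>s\<in>{Suc t..<r}. v s) * (v t - g))"
proof (induction r)
  case (Suc r)
  have "(\<Sum>t<Suc r. g ^ t * (\<Prod>s\<in>{Suc t..<Suc r}. v s) * (v t - g))
     = (\<Sum>t<r. g ^ t * (\<Prod>s\<in>{Suc t..<r}. v s) * (v t - g)) * v r + g ^ r * (v r - g)"
    by (simp add: sum_distrib_left sum_distrib_right prod.atLeastLessThan_Suc mult_ac)
  also have "\<dots> = ((\<Prod>t<r. v t) - g ^ r) * v r + g ^ r * (v r - g)" by (simp only: Suc)
  finally show ?case by (simp add: algebra_simps)
qed simp

section \<open>Rarity of large common prime divisors\<close>

lemma card_multiples_le:
  assumes "q > 0"
  shows "real (card {i \<in> {1..n}. q dvd i}) \<le> real n / real q"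
proof -
  have "{i \<in> {1..n}. q dvd i} \<subseteq> (\<lambda>k. q * k) ` {1..n div q}"
  proof
    fix i assume i: "i \<in> {i \<in> {1..n}. q dvd i}"
    then obtain k where "i = q * k" by auto
    moreover from this have "k \<le> n div q" using i assms
      by (metis (no_types, lifting) atLeastAtMost_iff div_le_mono mem_Collect_eq nonzero_mult_div_cancel_left not_gr_zero)
    moreover from \<open>i = q * k\<close> have "1 \<le> k" using i by (cases k) auto
    ultimately show "i \<in> (\<lambda>k. q * k) ` {1..n div q}" by auto
  qed
  then have "card {i \<in> {1..n}. q dvd i} \<le> card ((\<lambda>k. q * k) ` {1..n div q})" by (intro card_mono) auto
  also have "\<dots> \<le> n div q" using card_image_le[of "{1..n div q}" "\<lambda>k. q * k"] by simp
  finally have "real (card {i \<in> {1..n}. q dvd i}) \<le> real (n div q)" by (rule of_nat_mono)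
  also have "\<dots> \<le> real n / real q"
  proof -
    have "real (n div q * q) \<le> real n" by (intro of_nat_mono) simp
    then show ?thesis using assms by (simp add: pos_le_divide_eq)
  qed
  finally show ?thesis .
qed

lemma sum_inverse_squares_tail:
  assumes "N > 0"
  shows "(\<Sum>q\<in>{N<..n}. 1 / (real q)\<^sup>2) \<le> 1 / real N"
proof -
  have *: "(\<Sum>q\<in>{N<..n}. 1 / (real q)\<^sup>2) \<le> 1 / real N - 1 / real n" if "N \<le> n" for n
    using that
  proof (induction n rule: dec_induct)
    case (step n)
    have n: "real n > 0" using step assms by simp
    have "{N<..Suc n} = insert (Suc n) {N<..n}" using step by auto
    then have "(\<Sum>q\<in>{N<..Suc n}. 1 / (real q)\<^sup>2) = 1 / (real (Suc n))\<^sup>2 + (\<Sum>q\<in>{N<..n}. 1 / (real q)\<^sup>2)" by simp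
    also have "\<dots> \<le> 1 / (real (Suc n))\<^sup>2 + (1 / real N - 1 / real n)" using step by simp
    \<comment> \<open>Telescoping: the right-hand side is 1 / (n (n + 1)).\<close>
    also have "1 / (real (Suc n))\<^sup>2 \<le> 1 / real n - 1 / real (Suc n)"
      using n by (simp add: divide_simps power2_eq_square)
    finally show ?case by simp
  qed simp
  show ?thesis
  proof (cases "N \<le> n")
    case True
    have "1 / real N - 1 / real n \<le> 1 / real N" by simp
    with * [OF True] show ?thesis by (rule order.trans)
  qed simp
qed

definition large_prime_divisors :: "nat \<Rightarrow> nat \<Rightarrow> nat set" where
  "large_prime_divisors N i = {q. prime q \<and> N < q \<and> q dvd i}"

lemma large_prime_divisors_subset: "i \<ge> 1 \<Longrightarrow> large_prime_divisors N i \<subseteq> {N<..i}"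
  unfolding large_prime_divisors_def by (auto dest: dvd_imp_le)

lemma finite_large_prime_divisors: "i \<ge> 1 \<Longrightarrow> finite (large_prime_divisors N i)"
  using large_prime_divisors_subset by (rule finite_subset) auto

lemma sum_inverse_large_prime_divisors:
  assumes N: "N > 0"
  shows "(\<Sum>i = 1..n. \<Sum>q\<in>large_prime_divisors N i. 1 / real q) \<le> real n / real N"
proof -
  have "(\<Sum>i = 1..n. \<Sum>q\<in>large_prime_divisors N i. 1 / real q)
      \<le> (\<Sum>i = 1..n. \<Sum>q\<in>{N<..n}. of_bool (q dvd i) * (1 / real q))"
  proof (intro sum_mono)
    fix i assume i: "i \<in> {1..n}"
    have "(\<Sum>q\<in>large_prime_divisors N i. 1 / real q)
       = (\<Sum>q\<in>large_prime_divisors N i. of_bool (q dvd i) * (1 / real q))"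
      by (intro sum.cong refl) (auto simp: large_prime_divisors_def)
    also have "\<dots> \<le> (\<Sum>q\<in>{N<..n}. of_bool (q dvd i) * (1 / real q))"
      using i large_prime_divisors_subset[of i N] by (intro sum_mono2) auto
    finally show "(\<Sum>q\<in>large_prime_divisors N i. 1 / real q) \<le> \<dots>" .
  qed
  also have "\<dots> = (\<Sum>q\<in>{N<..n}. real (card {i \<in> {1..n}. q dvd i}) * (1 / real q))"
  proof (subst sum.swap, intro sum.cong refl)
    fix q
    have "{1..n} \<inter> {i. q dvd i} = {i \<in> {1..n}. q dvd i}" by auto
    then show "(\<Sum>i = 1..n. of_bool (q dvd i) * (1 / real q)) = real (card {i \<in> {1..n}. q dvd i}) * (1 / real q)"
      unfolding sum_distrib_right[symmetric] by (simp add: of_bool_def sum.If_cases)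
  qed
  also have "\<dots> \<le> (\<Sum>q\<in>{N<..n}. real n / real q * (1 / real q))"
    by (intro sum_mono mult_right_mono card_multiples_le) auto
  also have "\<dots> = real n * (\<Sum>q\<in>{N<..n}. 1 / (real q)\<^sup>2)"
    by (simp add: sum_distrib_left power2_eq_square)
  also have "\<dots> \<le> real n * (1 / real N)"
    by (intro mult_left_mono sum_inverse_squares_tail N) simp
  finally show ?thesis by simp
qed

text \<open>A factor differs from 1 by p^(-min) (1 - (1 - p^(-max))^r), which Bernoulli's inequality
  bounds by r p^(-min - max), at most r / p^2. The product thus converges absolutely even for b1 =
  b2 = 1.\<close>

lemma tendsto_prod_local_density:
  assumes b: "b1 > 0" "b2 > 0"
  shows "(\<lambda>N. \<Prod>p\<in>primes_upto N. local_density b1 b2 r p)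
     \<longlonglongrightarrow> (\<Prod>p. if prime p then local_density b1 b2 r p else 1)"
proof -
  define f where "f = (\<lambda>p. if prime p then local_density b1 b2 r p else 1)"
  have bound: "norm (f p - 1) \<le> real r * (1 / real p ^ 2)" for p
  proof (cases "prime p")
    case True
    then have p: "real p \<ge> 1" using prime_ge_1_nat by simp
    define u v where "u = 1 / real p ^ min b1 b2" and "v = 1 / real p ^ max b1 b2"
    have "real p ^ 1 \<le> real p ^ min b1 b2" "real p ^ 1 \<le> real p ^ max b1 b2"
      using p b by (intro power_increasing; simp)+
    then have uv: "0 \<le> u" "u \<le> 1 / real p" "0 \<le> v" "v \<le> 1 / real p"
      using p unfolding u_def v_def by (auto intro!: divide_left_mono)
    have v1: "v \<le> 1" using uv p by (auto intro: order.trans)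
    have "1 - real r * v \<le> (1 - v) ^ r"
      using Bernoulli_inequality[of "- v" r] v1 by simp
    moreover have "(1 - v) ^ r \<le> 1" using uv v1 by (intro power_le_one) auto
    ultimately have "\<bar>(1 - v) ^ r - 1\<bar> \<le> real r * v" by linarith
    then have "u * \<bar>(1 - v) ^ r - 1\<bar> \<le> u * (real r * v)" using uv by (intro mult_left_mono)
    also have "\<dots> = real r * (u * v)" by simp
    also have "\<dots> \<le> real r * (1 / real p * (1 / real p))"
      using uv p by (intro mult_left_mono mult_mono) auto
    finally have "\<bar>u * ((1 - v) ^ r - 1)\<bar> \<le> real r * (1 / real p ^ 2)"
      using uv by (simp add: abs_mult power2_eq_square)
    moreover have "f p - 1 = u * ((1 - v) ^ r - 1)"
      using True by (simp add: f_def local_density_def u_def v_def algebra_simps)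
    ultimately show ?thesis by simp
  qed (simp add: f_def)
  have "summable (\<lambda>p. real r * (1 / real p ^ 2))"
    using inverse_power_summable[of 2, where 'a = real] by (intro summable_mult) (simp add: inverse_eq_divide)
  then have "summable (\<lambda>p. norm (f p - 1))"
    by (rule summable_comparison_test'[where N = 0]) (use bound in simp)
  then have "convergent_prod f"
    by (intro abs_convergent_prod_imp_convergent_prod summable_imp_abs_convergent_prod)
  then have "(\<lambda>N. \<Prod>p\<le>N. f p) \<longlonglongrightarrow> prodinf f" by (rule convergent_prod_LIMSEQ)
  moreover have "(\<Prod>p\<le>N. f p) = (\<Prod>p\<in>primes_upto N. local_density b1 b2 r p)" for N
    unfolding f_def primes_upto_def by (subst prod.inter_filter[symmetric]) (auto intro!: prod.cong)
  ultimately show ?thesis by (simp add: f_def)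
qed

text \<open>The cutoff N is fixed first and n tends to infinity afterwards, so no uniformity of
  \<open>v\<close> and \<open>u\<close> in N is needed.\<close>

lemma tendsto_if_approximable:
  fixes s e :: "nat \<Rightarrow> real" and v u :: "nat \<Rightarrow> nat \<Rightarrow> real"
  assumes v: "\<And>N. (\<lambda>n. v N n) \<longlonglongrightarrow> P N" and u: "\<And>N. (\<lambda>n. u N n) \<longlonglongrightarrow> 0" and e: "e \<longlonglongrightarrow> 0"
    and P: "P \<longlonglongrightarrow> l"
    and bound: "\<And>N n. N \<ge> 1 \<Longrightarrow> n \<ge> 1 \<Longrightarrow> \<bar>s n - v N n\<bar> \<le> u N n + e n + c / real N"
  shows "s \<longlonglongrightarrow> l"
proof (rule LIMSEQ_I)
  fix \<epsilon> :: real assume "\<epsilon> > 0"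
  then have \<epsilon>: "\<epsilon> / 5 > 0" by simp
  have "(\<lambda>N. c / real N) \<longlonglongrightarrow> 0" by (rule lim_const_over_n)
  then have "\<forall>\<^sub>F N in sequentially. \<bar>c / real N\<bar> < \<epsilon> / 5"
    using tendstoD[OF _ \<epsilon>] by (fastforce simp: dist_real_def)
  moreover have "\<forall>\<^sub>F N in sequentially. \<bar>P N - l\<bar> < \<epsilon> / 5"
    using tendstoD[OF P \<epsilon>] by (simp add: dist_real_def)
  ultimately have "\<forall>\<^sub>F N in sequentially. \<bar>c / real N\<bar> < \<epsilon> / 5 \<and> \<bar>P N - l\<bar> < \<epsilon> / 5 \<and> N \<ge> 1"
    using eventually_ge_at_top[of 1] by eventually_elim auto
  then obtain N where N: "\<bar>c / real N\<bar> < \<epsilon> / 5" "\<bar>P N - l\<bar> < \<epsilon> / 5" "N \<ge> 1"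
    by (auto dest: eventually_happens)
  have "\<forall>\<^sub>F n in sequentially. \<bar>s n - l\<bar> < \<epsilon>"
    using tendstoD[OF v[of N] \<epsilon>] tendstoD[OF u[of N] \<epsilon>] tendstoD[OF e \<epsilon>] eventually_ge_at_top[of 1]
  proof eventually_elim
    case (elim n)
    then show ?case using bound[OF N(3), of n] N unfolding dist_real_def by linarith
  qed
  then show "\<exists>no. \<forall>n\<ge>no. norm (s n - l) < \<epsilon>" by (simp add: eventually_sequentially)
qed

section \<open>Almost sure frequencies\<close>

context independent_walks
begin

lemma determined_by_prod:
  fixes F :: "'i \<Rightarrow> 'a \<Rightarrow> real"
  assumes "\<And>s. s \<in> S \<Longrightarrow> determined_by A (F s)"
  shows "determined_by A (\<lambda>\<omega>. \<Prod>s\<in>S. F s \<omega>)"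
  using assms unfolding determined_by_def by (intro allI impI prod.cong refl) blast

lemma AE_average_sieved:
  "AE \<omega> in M. (\<lambda>n. (\<Sum>i = 1..n. \<Prod>t<r. sieved b1 b2 N i (ones t 0 i \<omega>)) / real n)
     \<longlonglongrightarrow> (\<Prod>p\<in>primes_upto N. local_density b1 b2 r p)"
proof -
  define v g where "v = sieved b1 b2 N" and "g = sieved_mean b1 b2 N"
  \<comment> \<open>Discrete antiderivative in the position, so that \<open>v i x - g i\<close>
    becomes the difference of \<open>F i\<close> at x.\<close>
  define F where "F = (\<lambda>i k. \<Sum>l<k. v i l - g i)"
  define G where "G = (\<lambda>t i \<omega>. g i ^ t * (\<Prod>s\<in>{Suc t..<r}. v i (ones s 0 i \<omega>)))"
  have v01: "0 \<le> v i x" "v i x \<le> 1" for i x by (simp_all add: v_def sieved_eq_of_bool)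
  have g01: "0 \<le> g i" "g i \<le> 1" for i by (simp_all add: g_def sieved_mean_bounds)
  have "AE \<omega> in M. \<forall>t\<in>{..<r}. (\<lambda>n. (\<Sum>i = 1..n. G t i \<omega> * (F i (Suc (ones t 0 i \<omega>)) - F i (ones t 0 i \<omega>))) / real n) \<longlonglongrightarrow> 0"
  proof (subst AE_finite_all, simp, intro ballI)
    fix t assume "t \<in> {..<r}"
    then have t: "t < r" by simp
    show "AE \<omega> in M. (\<lambda>n. (\<Sum>i = 1..n. G t i \<omega> * (F i (Suc (ones t 0 i \<omega>)) - F i (ones t 0 i \<omega>))) / real n) \<longlonglongrightarrow> 0"
    proof (rule AE_average_walk_difference[OF t, of "real (modulus b1 b2 N)"])
      show "\<bar>F j k\<bar> \<le> real (modulus b1 b2 N) * (1 + ln (real j))" if "j \<ge> 1" for j k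
      proof -
        have "\<bar>F j k\<bar> \<le> real (modulus b1 b2 N) * 1"
          using sieved_partial_sum_bound by (simp add: F_def v_def g_def)
        also have "\<dots> \<le> real (modulus b1 b2 N) * (1 + ln (real j))"
          using that by (intro mult_left_mono) auto
        finally show ?thesis .
      qed
      show "\<bar>G t j \<omega>\<bar> \<le> 1" for j \<omega>
      proof -
        have "0 \<le> (\<Prod>s\<in>{Suc t..<r}. v j (ones s 0 j \<omega>))" "(\<Prod>s\<in>{Suc t..<r}. v j (ones s 0 j \<omega>)) \<le> 1"
          using v01 by (auto intro: prod_nonneg prod_le_1)
        moreover have "0 \<le> g j ^ t" "g j ^ t \<le> 1" using g01 by (auto intro: power_le_one)
        ultimately show ?thesis unfolding G_def by (simp add: abs_mult mult_le_one)
      qed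
      show "determined_by (({..<r} - {t}) \<times> {..<j}) (G t j)" for j
        unfolding G_def
      proof (intro determined_by_comp[where g = "\<lambda>z. g j ^ t * z"] determined_by_prod
          determined_by_comp[where g = "v j"])
        fix s assume "s \<in> {Suc t..<r}"
        then show "determined_by (({..<r} - {t}) \<times> {..<j}) (ones s 0 j)"
          by (intro determined_by_mono[OF determined_by_ones]) auto
      qed
    qed simp
  qed
  then show ?thesis
  proof eventually_elim
    case (elim \<omega>)
    have "(\<Prod>t<r. v i (ones t 0 i \<omega>)) - g i ^ r
       = (\<Sum>t<r. G t i \<omega> * (F i (Suc (ones t 0 i \<omega>)) - F i (ones t 0 i \<omega>)))" for i
      unfolding prod_minus_power_telescope by (intro sum.cong refl) (simp add: G_def F_def)
    then have "(\<Sum>i = 1..n. \<Prod>t<r. v i (ones t 0 i \<omega>)) / real n = (\<Sum>i = 1..n. g i ^ r) / real n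
       + (\<Sum>t<r. (\<Sum>i = 1..n. G t i \<omega> * (F i (Suc (ones t 0 i \<omega>)) - F i (ones t 0 i \<omega>))) / real n)" for n
      unfolding sum_divide_distrib[symmetric] add_divide_distrib[symmetric]
      by (subst sum.swap) (simp add: sum.distrib[symmetric] diff_eq_eq add.commute)
    moreover have "(\<lambda>n. (\<Sum>i = 1..n. g i ^ r) / real n
       + (\<Sum>t<r. (\<Sum>i = 1..n. G t i \<omega> * (F i (Suc (ones t 0 i \<omega>)) - F i (ones t 0 i \<omega>))) / real n))
       \<longlonglongrightarrow> (\<Prod>p\<in>primes_upto N. local_density b1 b2 r p) + (\<Sum>t<r. 0)"
      using elim unfolding g_def by (intro tendsto_add average_sieved_mean_power tendsto_sum) auto
    ultimately show ?case by (simp add: v_def)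
  qed
qed

lemma AE_average_multiples:
  assumes t: "t < r" and D: "\<And>j. j \<ge> 1 \<Longrightarrow> finite (D j)" "\<And>j d. j \<ge> 1 \<Longrightarrow> d \<in> D j \<Longrightarrow> d > 0"
    and card: "\<And>j. j \<ge> 1 \<Longrightarrow> real (card (D j)) \<le> c * (1 + ln (real j))" and c: "c \<ge> 0"
  shows "AE \<omega> in M. (\<lambda>n. (\<Sum>j = 1..n. \<Sum>d\<in>D j. of_bool (d dvd ones t 0 j \<omega> + a) - 1 / real d) / real n) \<longlonglongrightarrow> 0"
proof -
  define F where "F = (\<lambda>j k. \<Sum>l<k. \<Sum>d\<in>D j. of_bool (d dvd l + a) - 1 / real d)"
  have "AE \<omega> in M. (\<lambda>n. (\<Sum>j = 1..n. 1 * (F j (Suc (ones t 0 j \<omega>)) - F j (ones t 0 j \<omega>))) / real n) \<longlonglongrightarrow> 0"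
  proof (rule AE_average_walk_difference[OF t c])
    show "\<bar>F j k\<bar> \<le> c * (1 + ln (real j))" if j: "j \<ge> 1" for j k
    proof -
      \<comment> \<open>Each divisor contributes at most 1, so the bound is the number of divisors
        and not their size.\<close>
      have "\<bar>F j k\<bar> = \<bar>\<Sum>d\<in>D j. \<Sum>l<k. of_bool (d dvd l + a) - 1 / real d\<bar>"
        unfolding F_def by (subst sum.swap) simp
      also have "\<dots> \<le> (\<Sum>d\<in>D j. \<bar>\<Sum>l<k. of_bool (d dvd l + a) - 1 / real d\<bar>)" by (rule sum_abs)
      also have "\<dots> \<le> (\<Sum>d\<in>D j. 1)"
        using D(2)[OF j] by (intro sum_mono multiple_indicator_partial_sum_bound)
      also have "\<dots> \<le> c * (1 + ln (real j))" using card[OF j] by simp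
      finally show ?thesis .
    qed
  qed (auto simp: determined_by_const)
  then show ?thesis by (simp add: F_def)
qed

text \<open>
  Since the position lies between 0 and i, divisibility by the modulus i + 1 singles out the two
  boundary positions 0 and i, where the prime power criterion for visibility does not apply.  The
  singleton sums and the summand 0 put all three terms into the shape of \<open>AE_average_multiples\<close>.
\<close>
definition sieve_error :: "nat \<Rightarrow> nat \<Rightarrow> nat \<Rightarrow> 'a \<Rightarrow> real" where
  "sieve_error N t i \<omega> = (\<Sum>q\<in>large_prime_divisors N i. of_bool (q dvd ones t 0 i \<omega> + 0))
     + (\<Sum>d\<in>{Suc i}. of_bool (d dvd ones t 0 i \<omega> + 0)) + (\<Sum>d\<in>{Suc i}. of_bool (d dvd ones t 0 i \<omega> + 1))"

definition sieve_error_mean :: "nat \<Rightarrow> nat \<Rightarrow> real" where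
  "sieve_error_mean N i = (\<Sum>q\<in>large_prime_divisors N i. 1 / real q)
     + (\<Sum>d\<in>{Suc i}. 1 / real d) + (\<Sum>d\<in>{Suc i}. 1 / real d)"

lemma AE_average_sieve_error:
  assumes t: "t < r"
  shows "AE \<omega> in M. (\<lambda>n. (\<Sum>i = 1..n. sieve_error N t i \<omega> - sieve_error_mean N i) / real n) \<longlonglongrightarrow> 0"
proof -
  have Suc: "AE \<omega> in M. (\<lambda>n. (\<Sum>j = 1..n. \<Sum>d\<in>{Suc j}. of_bool (d dvd ones t 0 j \<omega> + a) - 1 / real d) / real n) \<longlonglongrightarrow> 0" for a
    by (rule AE_average_multiples[OF t, of _ 1]) auto
  have "AE \<omega> in M. (\<lambda>n. (\<Sum>j = 1..n. \<Sum>d\<in>large_prime_divisors N j. of_bool (d dvd ones t 0 j \<omega> + 0) - 1 / real d) / real n) \<longlonglongrightarrow> 0"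
  proof (rule AE_average_multiples[OF t, of _ 2])
    show "real (card (large_prime_divisors N j)) \<le> 2 * (1 + ln (real j))" if "j \<ge> 1" for j
      using that finite_large_prime_divisors[OF that]
      by (intro card_prime_divisors_le_ln) (auto simp: large_prime_divisors_def)
  qed (auto simp: finite_large_prime_divisors, auto simp: large_prime_divisors_def dest: prime_gt_0_nat)
  with Suc[of 0] Suc[of 1] show ?thesis
  proof eventually_elim
    case (elim \<omega>)
    have "(\<Sum>i = 1..n. sieve_error N t i \<omega> - sieve_error_mean N i) / real n =
        (\<Sum>j = 1..n. \<Sum>d\<in>large_prime_divisors N j. of_bool (d dvd ones t 0 j \<omega> + 0) - 1 / real d) / real n
        + (\<Sum>j = 1..n. \<Sum>d\<in>{Suc j}. of_bool (d dvd ones t 0 j \<omega> + 0) - 1 / real d) / real n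
        + (\<Sum>j = 1..n. \<Sum>d\<in>{Suc j}. of_bool (d dvd ones t 0 j \<omega> + 1) - 1 / real d) / real n" for n
      unfolding sieve_error_def sieve_error_mean_def sum_subtractf sum.distrib add_divide_distrib diff_divide_distrib
      by linarith
    then show ?case using tendsto_add[OF tendsto_add[OF elim(3) elim(1)] elim(2)] by simp
  qed
qed

lemma average_sieve_error_mean_le:
  assumes N: "N \<ge> 1" and n: "n \<ge> 1"
  shows "(\<Sum>i = 1..n. sieve_error_mean N i) / real n \<le> 1 / real N + 4 / sqrt (real n)"
proof -
  \<comment> \<open>A harmonic sum; any o(n) bound suffices, so the square root estimate is
    reused.\<close>
  have "(\<Sum>i = 1..n. 1 / real (Suc i)) \<le> (\<Sum>i = 1..n. 1 / sqrt (real i))"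
  proof (intro sum_mono divide_left_mono)
    fix i assume i: "i \<in> {1..n}"
    have "sqrt (real i) \<le> sqrt ((real (Suc i))\<^sup>2)"
      by (intro real_sqrt_le_mono) (simp add: power2_eq_square algebra_simps)
    then show "sqrt (real i) \<le> real (Suc i)" by simp
    show "0 < real (Suc i) * sqrt (real i)" using i by simp
  qed simp
  also have "\<dots> \<le> 2 * sqrt (real n)" by (rule sum_inverse_sqrt_le)
  finally have s: "(\<Sum>i = 1..n. 1 / real (Suc i)) \<le> 2 * sqrt (real n)" .
  have "(\<Sum>i = 1..n. sieve_error_mean N i) = (\<Sum>i = 1..n. \<Sum>q\<in>large_prime_divisors N i. 1 / real q)
     + 2 * (\<Sum>i = 1..n. 1 / real (Suc i))"
    by (simp add: sieve_error_mean_def sum.distrib sum_distrib_left)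
  also have "\<dots> \<le> real n / real N + 2 * (2 * sqrt (real n))"
    using N by (intro add_mono mult_left_mono s sum_inverse_large_prime_divisors) auto
  finally have "(\<Sum>i = 1..n. sieve_error_mean N i) / real n \<le> (real n / real N + 2 * (2 * sqrt (real n))) / real n"
    by (intro divide_right_mono) auto
  also have "\<dots> = 1 / real N + 4 / sqrt (real n)"
  proof -
    define s where "s = sqrt (real n)"
    have "s > 0" "real n = s * s" using n by (simp_all add: s_def)
    then show ?thesis unfolding s_def[symmetric] by (simp add: add_divide_distrib)
  qed
  finally show ?thesis .
qed

text \<open>If a single walk's visibility disagrees with the sieve, its position is on an axis or
  some prime above N divides both coordinates, hence also i. Either event contributes at least 1 to
  \<open>sieve_error\<close>.\<close>

lemma visible_sieve_approximation:
  assumes b: "b1 > 0" "b2 > 0" "coprime b1 b2" and i: "i \<ge> 1"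
  shows "\<bar>of_bool (\<forall>t<r. b_visible b1 b2 (walk (\<xi> t) i \<omega>)) - (\<Prod>t<r. sieved b1 b2 N i (ones t 0 i \<omega>))\<bar>
    \<le> (\<Sum>t<r. sieve_error N t i \<omega>)"
proof -
  have err0: "0 \<le> sieve_error N t i \<omega>" for t
    unfolding sieve_error_def by (intro add_nonneg_nonneg sum_nonneg) auto
  have err: "1 \<le> sieve_error N t i \<omega>"
    if "b_visible b1 b2 (walk (\<xi> t) i \<omega>) \<noteq> (\<forall>p\<in>primes_upto N. locally_visible b1 b2 p i (ones t 0 i \<omega>))" for t
  proof -
    define x where "x = ones t 0 i \<omega>"
    have xi: "x \<le> i" using ones_le[of t 0 i \<omega>] by (simp add: x_def)
    have big: "0 \<le> (\<Sum>q\<in>large_prime_divisors N i. of_bool (q dvd x + 0) :: real)" by (intro sum_nonneg) auto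
    consider "x = 0" | "x = i" | "0 < x" "x < i" using xi by linarith
    then show ?thesis
    proof cases
      case 1
      then show ?thesis using big unfolding sieve_error_def x_def[symmetric] by simp
    next
      case 2
      then show ?thesis using big unfolding sieve_error_def x_def[symmetric] by simp
    next
      case 3
      then have y: "i - x > 0" by simp
      have loc: "locally_visible b1 b2 p i x \<longleftrightarrow> \<not> (p ^ b1 dvd x \<and> p ^ b2 dvd i - x)" for p
      proof -
        have "int i - int x = int (i - x)" using 3 by simp
        then show ?thesis unfolding locally_visible_def by (metis of_nat_dvd_iff of_nat_power)
      qed
      have "b_visible b1 b2 (int x, int (i - x)) \<noteq> (\<forall>p\<in>primes_upto N. locally_visible b1 b2 p i x)"
        using that unfolding walk_eq x_def[symmetric] .
      \<comment> \<open>Off the axes the disagreement is one-sided: visible points always pass the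
        sieve, so the obstructing prime exceeds N.\<close>
      then obtain p where p: "prime p" "\<not> p \<le> N" "p ^ b1 dvd x" "p ^ b2 dvd i - x"
        unfolding b_visible_iff[OF b 3(1) y] loc primes_upto_def by blast
      have "p dvd x" "p dvd i - x" using p b by (meson dvd_power dvd_trans)+
      then have "p dvd i" using 3 by (metis dvd_add le_add_diff_inverse less_imp_le)
      then have "p \<in> large_prime_divisors N i" using p by (simp add: large_prime_divisors_def)
      then have "of_bool (p dvd x + 0) \<le> (\<Sum>q\<in>large_prime_divisors N i. of_bool (q dvd x + 0) :: real)"
        by (intro member_le_sum finite_large_prime_divisors i) auto
      then show ?thesis using \<open>p dvd x\<close> unfolding sieve_error_def x_def[symmetric] by simp
    qed
  qed
  have "(\<Prod>t<r. sieved b1 b2 N i (ones t 0 i \<omega>))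
      = of_bool (\<forall>t<r. \<forall>p\<in>primes_upto N. locally_visible b1 b2 p i (ones t 0 i \<omega>))"
    unfolding sieved_eq_of_bool by (auto simp: prod_zero_iff)
  moreover have "1 \<le> (\<Sum>t<r. sieve_error N t i \<omega>)" if "t < r" "1 \<le> sieve_error N t i \<omega>" for t
    using that(2) member_le_sum[of t "{..<r}" "\<lambda>t. sieve_error N t i \<omega>"] err0 that(1) by fastforce
  moreover have "0 \<le> (\<Sum>t<r. sieve_error N t i \<omega>)" by (intro sum_nonneg err0)
  ultimately show ?thesis using err by (smt (verit, best) of_bool_eq)
qed

lemma AE_visible_frequency:
  assumes b: "b1 > 0" "b2 > 0" "coprime b1 b2"
  shows "AE \<omega> in M. (\<lambda>n. (\<Sum>i = 1..n. of_bool (\<forall>t<r. b_visible b1 b2 (walk (\<xi> t) i \<omega>))) / real n)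
     \<longlonglongrightarrow> (\<Prod>p. if prime p then local_density b1 b2 r p else 1)"
proof -
  \<comment> \<open>Countably many cutoffs share one null set, so the limit in N can be taken for
    each remaining sample point.\<close>
  have "AE \<omega> in M. \<forall>N. (\<lambda>n. (\<Sum>i = 1..n. \<Prod>t<r. sieved b1 b2 N i (ones t 0 i \<omega>)) / real n)
     \<longlonglongrightarrow> (\<Prod>p\<in>primes_upto N. local_density b1 b2 r p)"
    unfolding AE_all_countable using AE_average_sieved by blast
  moreover have "AE \<omega> in M. \<forall>N. \<forall>t\<in>{..<r}.
      (\<lambda>n. (\<Sum>i = 1..n. sieve_error N t i \<omega> - sieve_error_mean N i) / real n) \<longlonglongrightarrow> 0"
    unfolding AE_all_countable by (intro allI AE_finite_allI AE_average_sieve_error) auto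
  ultimately show ?thesis
  proof eventually_elim
    case (elim \<omega>)
    define Y where "Y = (\<lambda>i. of_bool (\<forall>t<r. b_visible b1 b2 (walk (\<xi> t) i \<omega>)) :: real)"
    define V where "V = (\<lambda>N i. \<Prod>t<r. sieved b1 b2 N i (ones t 0 i \<omega>))"
    define U where "U = (\<lambda>N n. \<Sum>t<r. (\<Sum>i = 1..n. sieve_error N t i \<omega> - sieve_error_mean N i) / real n)"
    have "(\<lambda>n. (\<Sum>i = 1..n. Y i) / real n) \<longlonglongrightarrow> (\<Prod>p. if prime p then local_density b1 b2 r p else 1)"
    proof (rule tendsto_if_approximable[where c = "real r" and u = U and e = "\<lambda>n. real r * (4 / sqrt (real n))"])
      show "(\<lambda>n. (\<Sum>i = 1..n. V N i) / real n) \<longlonglongrightarrow> (\<Prod>p\<in>primes_upto N. local_density b1 b2 r p)" for N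
        using elim(1) by (simp add: V_def)
      have "(\<lambda>n. U N n) \<longlonglongrightarrow> (\<Sum>t<r. 0)" for N
        unfolding U_def using elim(2) by (intro tendsto_sum) auto
      then show "(\<lambda>n. U N n) \<longlonglongrightarrow> 0" for N by simp
      show "(\<lambda>n. real r * (4 / sqrt (real n))) \<longlonglongrightarrow> 0" by real_asymp
      show "(\<lambda>N. \<Prod>p\<in>primes_upto N. local_density b1 b2 r p)
         \<longlonglongrightarrow> (\<Prod>p. if prime p then local_density b1 b2 r p else 1)"
        by (rule tendsto_prod_local_density[OF b(1,2)])
      show "\<bar>(\<Sum>i = 1..n. Y i) / real n - (\<Sum>i = 1..n. V N i) / real n\<bar>
          \<le> U N n + real r * (4 / sqrt (real n)) + real r / real N" if N: "N \<ge> 1" and n: "n \<ge> 1" for N n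
      proof -
        have "\<bar>(\<Sum>i = 1..n. Y i) - (\<Sum>i = 1..n. V N i)\<bar> \<le> (\<Sum>i = 1..n. \<bar>Y i - V N i\<bar>)"
          unfolding sum_subtractf[symmetric] by (rule sum_abs)
        also have "\<dots> \<le> (\<Sum>i = 1..n. \<Sum>t<r. sieve_error N t i \<omega>)"
          unfolding Y_def V_def by (intro sum_mono visible_sieve_approximation b) auto
        also have "\<dots> = (\<Sum>t<r. \<Sum>i = 1..n. sieve_error N t i \<omega>)" by (rule sum.swap)
        also have "\<dots> = (\<Sum>t<r. (\<Sum>i = 1..n. sieve_error N t i \<omega> - sieve_error_mean N i) + (\<Sum>i = 1..n. sieve_error_mean N i))"
          by (simp add: sum_subtractf)
        finally have le: "\<bar>(\<Sum>i = 1..n. Y i) - (\<Sum>i = 1..n. V N i)\<bar> / real n \<le>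
            (\<Sum>t<r. (\<Sum>i = 1..n. sieve_error N t i \<omega> - sieve_error_mean N i) + (\<Sum>i = 1..n. sieve_error_mean N i)) / real n"
          by (rule divide_right_mono) simp
        also have "\<dots> = U N n + (\<Sum>t<r. (\<Sum>i = 1..n. sieve_error_mean N i) / real n)"
          by (simp add: U_def sum_divide_distrib[symmetric] sum.distrib add_divide_distrib)
        also have "\<dots> \<le> U N n + (\<Sum>t<r. 1 / real N + 4 / sqrt (real n))"
          by (intro add_left_mono sum_mono average_sieve_error_mean_le N n)
        also have "\<dots> = U N n + real r * (4 / sqrt (real n)) + real r / real N"
          by (simp add: distrib_left)
        finally show ?thesis by (simp add: diff_divide_distrib[symmetric])
      qed
    qed
    then show ?case by (simp add: Y_def)
  qed
qed

end

theorem theorem1p2: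
  fixes M :: "'a measure" and \<xi> :: "nat \<Rightarrow> nat \<Rightarrow> 'a \<Rightarrow> bool"
    and \<alpha> :: "nat \<Rightarrow> real" and b1 b2 r :: nat
  assumes "prob_space M"
    and "b1 > 0" and "b2 > 0" and "coprime b1 b2"
    and "r \<ge> 1"
    and "\<forall>j<r. 0 < \<alpha> j \<and> \<alpha> j < 1"
    and "prob_space.indep_vars M (\<lambda>_. count_space UNIV) (\<lambda>(j, i). \<xi> j i) ({..<r} \<times> UNIV)"
    and "\<forall>j<r. \<forall>i. prob_space.prob M {\<omega> \<in> space M. \<xi> j i \<omega>} = \<alpha> j"
  shows "AE \<omega> in M.
    (\<lambda>n. (\<Sum>i = 1..n. if (\<forall>j<r. b_visible b1 b2 (walk (\<xi> j) i \<omega>)) then 1 else 0) / real n)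
    \<longlonglongrightarrow>
    (\<Prod>p. if prime p then
        1 - 1 / real p ^ min b1 b2 + (1 / real p ^ min b1 b2) * (1 - 1 / real p ^ max b1 b2) ^ r
      else 1)"
proof -
  interpret independent_walks M \<xi> \<alpha> r
    unfolding independent_walks_def independent_walks_axioms_def using assms by blast
  show ?thesis
    using AE_visible_frequency[OF assms(2-4)] unfolding local_density_def of_bool_def .
qed

end
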